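(* Let $F$ be an algebraically closed field of characteristic $\neq 2$, $R=F[t]$ with the involution ${}^*$ described in the context. Let $\varepsilon\in\{1,-1\}$, let $A\in M_n(R)$ satisfy $A^*=\varepsilon A$, and let $f_1,\ldots,f_n$ be the invariant factors of $A$. It is known that every maximal run of consecutive invariant factors $f_i,\ldots,f_j$ that are nonzero and satisfy $f_m^*=-\varepsilon f_m$ has even length, and can be written as pairs $(g_k,h_k)=(f_k,f_{k+1})$, $k=i,i+2,\ldots,j-1$, with $h_k=g_kp_kp_k^*$ for some pure $p_k\in R$. Form the block diagonal matrix $B$ whose blocks are: (i) the $1\times1$ matrices $(f_i)$ for each $i$ with $f_i^*=\varepsilon f_i$; (ii) for each such pair $(g_k,h_k=g_kp_kp_k^* )$, the $2\times 2$ matrix $$\begin{pmatrix}0&g_kp_k\\ \varepsilon (g_kp_k)^*&0\end{pmatrix}.$$ Then $A$ is congruent to $B$. Moreover, such $B$ is unique up to the ordering of the diagonal blocks and the choice of the factorizations $h_k=g_kp_kp_k^*$.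
   Context: $R=F[t]$ is the polynomial ring over $F$, and ${}^*$ is the $F$-algebra involution of $R$ that is the identity on $F$ and sends $t$ to $-t$. A nonzero $a\in R$ is pure if $\gcd(a,a^* )=1$. For $A=(a_{ij})\in M_n(R)$, $A^*$ is the matrix whose $(i,j)$ entry is $a_{ji}^*$. Congruence: $B=S^*AS$ for some $S\in\mathrm{GL}_n(R)$. The invariant factors of $A$ are the diagonal entries of its Smith normal form over the PID $R$, the nonzero ones normalized to be monic; for $A^*=\pm A$ they are all even or odd. *)

theory Defs
  imports "HOL-Computational_Algebra.Polynomial_Factorial" "Jordan_Normal_Form.Matrix"
begin

definition pstar :: "'a::comm_ring_1 poly \<Rightarrow> 'a poly" where
  "pstar a = pcompose a [:0, -1:]"

definition pure :: "'a::field poly \<Rightarrow> bool" where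
  "pure a \<longleftrightarrow> a \<noteq> 0 \<and> coprime a (pstar a)"

definition mat_star :: "'a::comm_ring_1 poly mat \<Rightarrow> 'a poly mat" where
  "mat_star A = mat (dim_col A) (dim_row A) (\<lambda>(i,j). pstar (A $$ (j,i)))"

definition congruent_mat :: "nat \<Rightarrow> 'a::comm_ring_1 poly mat \<Rightarrow> 'a poly mat \<Rightarrow> bool" where
  "congruent_mat n A B \<longleftrightarrow>
     (\<exists>S \<in> carrier_mat n n. invertible_mat S \<and> B = mat_star S * A * S)"

definition diag_of :: "nat \<Rightarrow> (nat \<Rightarrow> 'a::zero) \<Rightarrow> 'a mat" where
  "diag_of n d = mat n n (\<lambda>(i,j). if i = j then d i else 0)"

definition smith_chain :: "nat \<Rightarrow> (nat \<Rightarrow> 'a::field poly) \<Rightarrow> bool" where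
  "smith_chain n d \<longleftrightarrow>
     (\<forall>i. Suc i < n \<longrightarrow> d i dvd d (Suc i)) \<and> (\<forall>i<n. d i = 0 \<or> lead_coeff (d i) = 1)"

definition invariant_factors :: "nat \<Rightarrow> 'a::field poly mat \<Rightarrow> (nat \<Rightarrow> 'a poly) \<Rightarrow> bool" where
  "invariant_factors n A fs \<longleftrightarrow> A \<in> carrier_mat n n \<and> smith_chain n fs \<and>
     (\<exists>P \<in> carrier_mat n n. \<exists>Q \<in> carrier_mat n n.
        invertible_mat P \<and> invertible_mat Q \<and> P * A * Q = diag_of n fs)"

definition oddt :: "'a::field \<Rightarrow> nat \<Rightarrow> (nat \<Rightarrow> 'a poly) \<Rightarrow> nat \<Rightarrow> bool" where
  "oddt eps n fs m \<longleftrightarrow> m < n \<and> fs m \<noteq> 0 \<and> pstar (fs m) = Polynomial.smult (- eps) (fs m)"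

text \<open>k starts a pair (g_k,h_k) = (f_k, f_(k+1)): k is of odd type and the part of its
  maximal run of odd-type indices lying before k has even length.\<close>
definition pair_start :: "'a::field \<Rightarrow> nat \<Rightarrow> (nat \<Rightarrow> 'a poly) \<Rightarrow> nat \<Rightarrow> bool" where
  "pair_start eps n fs k \<longleftrightarrow> oddt eps n fs k \<and>
     even (card {j. j < k \<and> (\<forall>l\<in>{j..<k}. oddt eps n fs l)})"

text \<open>p gives factorizations h_k = g_k p_k p_k* with p_k pure for every pair.
  (This also forces every maximal run to have even length.)\<close>
definition valid_pairing :: "'a::field \<Rightarrow> nat \<Rightarrow> (nat \<Rightarrow> 'a poly) \<Rightarrow> (nat \<Rightarrow> 'a poly) \<Rightarrow> bool" where
  "valid_pairing eps n fs p \<longleftrightarrow>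
     (\<forall>k. pair_start eps n fs k \<longrightarrow>
        Suc k < n \<and> oddt eps n fs (Suc k) \<and> pure (p k) \<and>
        fs (Suc k) = fs k * p k * pstar (p k))"

text \<open>Every entry is either of type (i) (f* = eps f, including f = 0) or of odd type,
  so that every index is covered by a block of B.\<close>
definition typed_seq :: "'a::field \<Rightarrow> nat \<Rightarrow> (nat \<Rightarrow> 'a poly) \<Rightarrow> bool" where
  "typed_seq eps n fs \<longleftrightarrow>
     (\<forall>i<n. pstar (fs i) = Polynomial.smult eps (fs i) \<or> oddt eps n fs i)"

text \<open>The block diagonal matrix B: 1x1 blocks (f_i) for f_i* = eps f_i, and 2x2 blocks
  [[0, g p],[eps (g p)*, 0]] for the pairs, placed along the diagonal in index order.\<close>
definition canon :: "'a::field \<Rightarrow> nat \<Rightarrow> (nat \<Rightarrow> 'a poly) \<Rightarrow> (nat \<Rightarrow> 'a poly) \<Rightarrow> 'a poly mat" where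
  "canon eps n fs p = mat n n (\<lambda>(i,j).
     if i = j \<and> pstar (fs i) = Polynomial.smult eps (fs i) then fs i
     else if pair_start eps n fs i \<and> j = Suc i then fs i * p i
     else if pair_start eps n fs j \<and> i = Suc j then Polynomial.smult eps (pstar (fs j * p j))
     else 0)"

end

theory Submission
  imports Defs "Jordan_Normal_Form.Determinant"
begin

text \<open>
  A Hermitian or skew-Hermitian matrix is split recursively.  Let f be the monic gcd of its entries
  and divide by it; the quotient is Hermitian or skew-Hermitian and its form h attains the value 1.

  Since F is algebraically closed, every even polynomial is a norm w w*.  If h(x, y) = 1, a = h(x, x)
  and w w* is minus the Gram determinant of (x, y) (skew case: the determinant itself), then
  (w r - r*) x + a r* y is isotropic for every r, and for generic r some vector pairs with it to w.
  For pure q, the traces q u + (q u)* are all the even polynomials, which lets one adjust values of h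
  along isotropic vectors.

  In the Hermitian case h therefore represents 1, and a block (f) splits off.  In the skew case choose
  isotropic z and X with q = h(z, X) pure of minimal degree.  Minimality forces q | h(z, -) and
  q* | h(X, -), so the plane of z and X splits off; applied to isotropic vectors z + b X + v with v
  orthogonal to the plane, it forces q q* to divide h on the complement.  Hence the invariant factors
  appear in order, and their uniqueness identifies them with the given ones.
\<close>

section \<open>Polynomials with the involution\<close>

text \<open>The symmetry of f decides the type of the block. As f is a value of the form, f* is f or
  -f, and dividing by f keeps or reverses the sign of the symmetry: the quotient is Hermitian
  exactly when f* = eps f. Hence only two cases remain, whatever eps is.

  The obstacle is the point t = 0. Up to constants t is the only prime associated to its conjugate,
  so a power of t in a norm w w* spoils the purity of w. In the skew case the values h(x, x) are odd
  and vanish at 0, the Gram determinant is 1 there, and w can be taken pure. In the Hermitian case w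
  is t^k times a pure polynomial; the corrections made along an isotropic vector are then multiples
  of t^(2k), and its partner must have a value that is nonzero at 0. This is why constant terms are
  tracked, and why w(0) = 1 is avoided when h(x, x) vanishes at 0.

  The recursion produces its own factors p, whereas the statement prescribes them. Two pure factors
  of the same norm differ, up to sign, by replacing a divisor m by m*, and a change of basis
  realizes this replacement.\<close>

lemma poly_pstar [simp]: "poly (pstar a) x = poly a (- x)"
  by (simp add: pstar_def poly_pcompose)

lemma pstar_add [simp]: "pstar (a + b) = pstar a + pstar b"
  and pstar_diff [simp]: "pstar (a - b) = pstar a - pstar b"
  and pstar_uminus [simp]: "pstar (- a) = - pstar a"
  and pstar_mult [simp]: "pstar (a * b) = pstar a * pstar b"
  and pstar_smult [simp]: "pstar (Polynomial.smult c a) = Polynomial.smult c (pstar a)"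
  and pstar_0 [simp]: "pstar 0 = 0"
  and pstar_1 [simp]: "pstar 1 = 1"
  and pstar_const [simp]: "pstar [:c:] = [:c:]"
  by (simp_all add: pstar_def pcompose_add pcompose_diff pcompose_uminus pcompose_mult
      pcompose_smult pcompose_1)

lemma pstar_pCons [simp]: "pstar (pCons c a) = pCons c (- pstar a)"
  by (simp add: pstar_def pcompose_pCons)

lemma pstar_sum [simp]: "pstar (sum f I) = (\<Sum>i\<in>I. pstar (f i))"
  by (simp add: pstar_def pcompose_sum)

lemma pstar_power [simp]: "pstar (a ^ k) = pstar a ^ k"
  by (induction k) simp_all

lemma pstar_pstar [simp]: "pstar (pstar a) = a"
  by (simp add: pstar_def pcompose_assoc [symmetric] pcompose_pCons)

lemma pstar_eq_0_iff [simp]: "pstar a = 0 \<longleftrightarrow> a = 0"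
  by (metis pstar_0 pstar_pstar)

lemma degree_pstar [simp]: "degree (pstar (a :: 'a::idom poly)) = degree a"
  by (simp add: pstar_def degree_pcompose)

lemma pstar_dvd_pstar: "a dvd b \<Longrightarrow> pstar a dvd pstar b"
  by (metis dvd_def pstar_mult)

text \<open>A nonzero element of least degree in the ideal generated by \<open>a\<close> and
  \<open>b\<close> divides the whole ideal, because the remainder of a division by it lies in the
  ideal again.\<close>

lemma bezout_poly:
  fixes a b :: "'a::field poly"
  obtains x y where "a * x + b * y dvd a" "a * x + b * y dvd b"
proof (cases "a = 0 \<and> b = 0")
  case True
  then show ?thesis using that[of 0 0] by simp
next
  case False
  define I where "I = {a * x + b * y | x y. True}"
  have "\<exists>g. g \<in> I \<and> g \<noteq> 0"
  proof (cases "a = 0")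
    case True
    have "b \<in> I" unfolding I_def by (rule CollectI, rule exI[of _ 0], rule exI[of _ 1]) simp
    then show ?thesis using True False by auto
  next
    case nz: False
    have "a \<in> I" unfolding I_def by (rule CollectI, rule exI[of _ 1], rule exI[of _ 0]) simp
    then show ?thesis using nz by auto
  qed
  then obtain g where g: "g \<in> I" "g \<noteq> 0" and
    min: "\<And>h. h \<in> I \<Longrightarrow> h \<noteq> 0 \<Longrightarrow> degree g \<le> degree h"
    using ex_has_least_nat[of "\<lambda>g. g \<in> I \<and> g \<noteq> 0" _ degree] by metis
  obtain x y where xy: "g = a * x + b * y" using g by (auto simp: I_def)
  have *: "g dvd a * u + b * v" for u v
  proof (rule ccontr)
    assume n: "\<not> g dvd a * u + b * v"
    define h where "h = a * u + b * v"
    have "h mod g = a * (u - x * (h div g)) + b * (v - y * (h div g))"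
      unfolding minus_div_mult_eq_mod[symmetric] by (simp add: h_def xy algebra_simps)
    then have "h mod g \<in> I" by (auto simp: I_def)
    moreover have "h mod g \<noteq> 0" using n by (simp add: h_def mod_eq_0_iff_dvd)
    ultimately show False using min[of "h mod g"] degree_mod_less[of g h] g by auto
  qed
  show ?thesis using that[of x y] *[of 1 0] *[of 0 1] by (simp add: xy)
qed

lemma coprime_bezout:
  fixes a b :: "'a::field poly"
  assumes "coprime a b"
  obtains x y where "a * x + b * y = 1"
proof -
  obtain x y where xy: "a * x + b * y dvd a" "a * x + b * y dvd b" by (rule bezout_poly)
  have "a * x + b * y dvd 1" using coprime_common_divisor[OF assms xy] by simp
  then obtain c where "1 = (a * x + b * y) * c" by (elim dvdE)
  then show ?thesis using that[of "x * c" "y * c"] by (simp add: algebra_simps)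
qed

text \<open>Besides the common factor this supplies a matrix of determinant one with first column
  \<alpha>, \<beta>. It serves to complete columns to a basis and to compare two factorizations of
  one norm.\<close>

lemma gcd_decomposition:
  fixes a b :: "'a::field poly"
  obtains g \<alpha> \<beta> \<gamma> \<delta> where "a = g * \<alpha>" "b = g * \<beta>" "\<alpha> * \<delta> - \<beta> * \<gamma> = 1"
proof (cases "a = 0 \<and> b = 0")
  case True
  then show ?thesis using that[of 0 1 0 1 0] by simp
next
  case False
  obtain x y where xy: "a * x + b * y dvd a" "a * x + b * y dvd b" by (rule bezout_poly)
  define g where "g = a * x + b * y"
  obtain \<alpha> \<beta> where ab: "a = g * \<alpha>" "b = g * \<beta>" using xy unfolding g_def[symmetric] by (elim dvdE)
  have "g \<noteq> 0" using False ab by auto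
  have "g * (\<alpha> * x + \<beta> * y) = g * 1" using g_def ab by (simp add: algebra_simps)
  then have "\<alpha> * x + \<beta> * y = 1" using \<open>g \<noteq> 0\<close> mult_left_cancel by blast
  then show ?thesis using that[of g \<alpha> \<beta> x "- y"] ab by simp
qed

lemma coprime_if_no_common_root:
  fixes a b :: "'a::alg_closed_field poly"
  assumes "a \<noteq> 0" and "\<And>x. poly a x = 0 \<Longrightarrow> poly b x \<noteq> 0"
  shows "coprime a b"
proof (rule coprimeI)
  fix d assume d: "d dvd a" "d dvd b"
  show "is_unit d"
  proof (rule ccontr)
    assume nu: "\<not> is_unit d"
    have "d \<noteq> 0" using d assms(1) by auto
    then have "degree d > 0" using nu is_unit_iff_degree by blast
    then obtain x where "poly d x = 0" using alg_closed_imp_poly_has_root by blast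
    then show False using d assms(2)[of x] by (metis dvd_trans poly_eq_0_iff_dvd)
  qed
qed

text \<open>Roots x and -x would make t - x a common factor of \<open>p\<close> and
  \<open>pstar p\<close>. The case x = 0 shows that a pure polynomial does not vanish at 0.\<close>

lemma pure_root:
  assumes "pure p" "poly p x = 0"
  shows "poly p (- x) \<noteq> 0"
proof
  assume "poly p (- x) = 0"
  then have "[:- x, 1:] dvd p" "[:- x, 1:] dvd pstar p"
    using assms(2) by (simp_all add: poly_eq_0_iff_dvd[symmetric])
  then have "is_unit [:- x, 1:]" using assms(1) by (meson coprime_common_divisor pure_def)
  then show False by (simp add: is_unit_iff_degree)
qed

lemma pureI:
  fixes p :: "'a::alg_closed_field poly"
  assumes "p \<noteq> 0" "\<And>x. poly p x = 0 \<Longrightarrow> poly p (- x) \<noteq> 0"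
  shows "pure p"
  using assms coprime_if_no_common_root[of p "pstar p"] by (simp add: pure_def)

lemma pure_dvd:
  fixes p :: "'a::field poly"
  assumes "pure p" "q dvd p"
  shows "pure q"
  using assms unfolding pure_def
  by (metis coprime_divisors dvd_0_left pstar_dvd_pstar)

lemma pure_pstar [simp]: "pure (pstar p) \<longleftrightarrow> pure p"
  by (auto simp: pure_def coprime_commute)

lemma pure_smult [simp]: "c \<noteq> 0 \<Longrightarrow> pure (Polynomial.smult c p) \<longleftrightarrow> pure p"
  using pure_dvd[of p "Polynomial.smult c p"] pure_dvd[of "Polynomial.smult c p" p]
  by (auto simp: smult_dvd_iff dvd_smult)

lemma two_half:
  assumes "(2::'a::field) \<noteq> 0"
  shows "[:1 / 2 :: 'a:] + [:1 / 2:] = 1"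
  using assms by (simp add: one_pCons del: one_add_one flip: add_divide_distrib)

text \<open>A Bezout relation \<open>p * x + pstar p * y = 1\<close> is averaged with its conjugate,
  so \<open>u\<close> is half of \<open>x + pstar y\<close>.\<close>

lemma pure_trace:
  fixes p :: "'a::field poly"
  assumes "(2::'a) \<noteq> 0" "pure p"
  obtains u where "p * u + pstar p * pstar u = 1"
proof -
  obtain x y where xy: "p * x + pstar p * y = 1"
    using assms(2) unfolding pure_def by (meson coprime_bezout)
  then have xy': "pstar p * pstar x + p * pstar y = 1"
    by (metis pstar_1 pstar_add pstar_mult pstar_pstar)
  have "p * ([:1/2:] * (x + pstar y)) + pstar p * pstar ([:1/2:] * (x + pstar y)) =
      [:1/2:] * (p * x + pstar p * y) + [:1/2:] * (pstar p * pstar x + p * pstar y)"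
    by (simp only: pstar_mult pstar_add pstar_pstar pstar_const distrib_left distrib_right ac_simps)
  also have "\<dots> = 1" unfolding xy xy' using two_half[OF assms(1)] by simp
  finally show ?thesis by (rule that)
qed

text \<open>A solution for trace 1 is multiplied by \<open>k\<close>; since \<open>k\<close> is
  \<open>d\<close> times \<open>pstar k\<close>, the conjugate term absorbs the same factor. With
  \<open>d = 1\<close> the targets are the even, with \<open>d = - 1\<close> the odd
  polynomials.\<close>

lemma pure_trace_eq:
  fixes p :: "'a::field poly"
  assumes "(2::'a) \<noteq> 0" "pure p" "pstar k = Polynomial.smult d k"
  obtains u where "p * u + Polynomial.smult d (pstar p * pstar u) = k"
proof -
  obtain u where u: "p * u + pstar p * pstar u = 1" using pure_trace assms by blast
  have dd: "k = Polynomial.smult d (pstar k)" using assms(3) by (metis pstar_pstar pstar_smult)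
  have "p * (k * u) + Polynomial.smult d (pstar p * pstar (k * u)) =
      k * (p * u) + Polynomial.smult d (pstar k) * (pstar p * pstar u)"
    by (simp add: ac_simps)
  also have "\<dots> = k * (p * u + pstar p * pstar u)"
    unfolding dd[symmetric] by (simp add: algebra_simps)
  finally show ?thesis using that[of "k * u"] unfolding u by simp
qed

lemma infinite_alg_closed: "infinite (UNIV :: 'a::alg_closed_field set)"
proof
  assume fin: "finite (UNIV :: 'a set)"
  define q :: "'a poly" where "q = (\<Prod>a\<in>UNIV. [:- a, 1:])"
  have 0: "poly q x = 0" for x using fin by (simp add: q_def poly_prod)
  have "degree q = card (UNIV :: 'a set)"
    unfolding q_def by (subst degree_prod_eq_sum_degree) auto
  then have "degree q > 0" using fin by (simp add: card_gt_0_iff)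
  then have "degree (q + 1) > 0" by (simp add: degree_add_eq_left)
  then obtain x where "poly (q + 1) x = 0" using alg_closed_imp_poly_has_root by blast
  then show False using 0 by simp
qed

text \<open>The roots come in pairs x, -x with x nonzero; one linear factor of each pair goes to
  \<open>v\<close>, the other to \<open>pstar v\<close>.\<close>

lemma even_poly_norm_pure:
  fixes V :: "'a::alg_closed_field poly"
  assumes two: "(2::'a) \<noteq> 0" and "pstar V = V" "poly V 0 \<noteq> 0"
  shows "\<exists>v. pure v \<and> V = v * pstar v"
  using assms(2,3)
proof (induction "degree V" arbitrary: V rule: less_induct)
  case less
  show ?case
  proof (cases "degree V = 0")
    case True
    then obtain c where c: "V = [:c:]" by (rule degree_eq_zeroE)
    obtain r where r: "r ^ 2 = c" using nth_root_exists[of 2 c] by auto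
    have "r \<noteq> 0" using r c less.prems by auto
    then have "pure [:r:]" by (intro pureI) auto
    moreover have "V = [:r:] * pstar [:r:]" using c r by (simp add: power2_eq_square)
    ultimately show ?thesis by blast
  next
    case False
    then obtain x where x: "poly V x = 0" using alg_closed_imp_poly_has_root by blast
    have x0: "x \<noteq> 0" using x less.prems by auto
    obtain U where U: "V = [:- x, 1:] * U" using x by (metis dvdE poly_eq_0_iff_dvd)
    have "poly V (- x) = 0" using x less.prems(1) by (metis poly_pstar)
    then have "poly U (- x) = 0" using x0 two by (simp add: U flip: mult_2)
    then obtain W where W: "U = [:x, 1:] * W"
      by (metis dvdE poly_eq_0_iff_dvd minus_minus)
    define Q where "Q = [:- x, 1:] * [:x, 1:]"
    have VQ: "V = Q * W" unfolding U W Q_def by (simp only: mult.assoc)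
    have "V \<noteq> 0" using less.prems by auto
    have Q: "pstar Q = Q" "Q \<noteq> 0" by (simp_all add: Q_def)
    have "Q * pstar W = Q * W" using less.prems(1) VQ Q by (metis pstar_mult)
    then have "pstar W = W" using Q mult_left_cancel by blast
    moreover have W0: "poly W 0 \<noteq> 0" using less.prems VQ by auto
    moreover have "degree W < degree V"
      using \<open>V \<noteq> 0\<close> unfolding U W by (auto simp: degree_mult_eq simp del: mult_pCons_left)
    ultimately obtain w where w: "pure w" "W = w * pstar w" using less.hyps by blast
    \<comment> \<open>The product of t - y with its conjugate is y^2 - t^2, so a square root of -1
      has to correct the sign.\<close>
    obtain i :: 'a where i: "i ^ 2 = - 1" using nth_root_exists[of 2 "-1::'a"] by auto
    have i0: "i \<noteq> 0" using i by auto
    have wnz: "w \<noteq> 0" using w by (auto simp: pure_def)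
    \<comment> \<open>Purity survives the new root \<open>y\<close> if \<open>- y\<close> is not a
      root of \<open>w\<close>. As \<open>w\<close> is pure, it cannot vanish at both x and -x, so
      one of the two choices of \<open>y\<close> qualifies.\<close>
    have main: "\<exists>v. pure v \<and> V = v * pstar v"
      if y: "y = x \<or> y = - x" and wy: "poly w (- y) \<noteq> 0" for y
    proof (intro exI conjI)
      define v where "v = [:i:] * ([:- y, 1:] * w)"
      have pv: "poly v z = i * ((z - y) * poly w z)" for z by (simp add: v_def algebra_simps)
      show "pure v"
      proof (rule pureI)
        show "v \<noteq> 0" using i0 wnz by (simp add: v_def del: mult_pCons_left)
      next
        fix z assume "poly v z = 0"
        then have "z = y \<or> poly w z = 0" using i0 by (auto simp: pv)
        then show "poly v (- z) \<noteq> 0"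
        proof
          assume "z = y"
          moreover have "- y - y \<noteq> 0" using x0 y two by (auto simp flip: mult_2 simp: minus_equation_iff[of "_ + _"])
          ultimately show ?thesis using i0 wy by (auto simp: pv)
        next
          assume z: "poly w z = 0"
          then have "z \<noteq> - y" using wy by auto
          then have "- z - y \<noteq> 0" by (metis add.inverse_inverse eq_iff_diff_eq_0)
          then show ?thesis using i0 pure_root[OF w(1) z] by (auto simp: pv)
        qed
      qed
      have "v * pstar v = ([:i:] * [:i:]) * ([:- y, 1:] * [:- y, - 1:]) * (w * pstar w)"
      proof -
        have ps: "pstar [:i:] = [:i:]" "pstar [:- y, 1:] = [:- y, - 1:]" by simp_all
        show ?thesis unfolding v_def pstar_mult ps by (simp only: ac_simps)
      qed
      also have "[:i:] * [:i:] = - 1" using i by (simp add: power2_eq_square one_pCons)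
      also have "- 1 * ([:- y, 1:] * [:- y, - 1:]) = Q" using y by (auto simp: Q_def one_pCons)
      finally show "V = v * pstar v" using VQ w by simp
    qed
    show ?thesis
    proof (cases "poly w (- x) = 0")
      case True
      then have "poly w x \<noteq> 0" using pure_root[OF w(1) True] by simp
      then show ?thesis using main[of "- x"] by simp
    next
      case False then show ?thesis using main[of x] by simp
    qed
  qed
qed

text \<open>An even polynomial that vanishes at 0 is divisible by t^2 with even quotient. Since t t*
  is -t^2, each such step costs a square root of -1. The power of t is kept apart from
  \<open>w\<close> because t is not pure.\<close>

lemma even_poly_norm:
  fixes V :: "'a::alg_closed_field poly"
  assumes two: "(2::'a) \<noteq> 0" and "pstar V = V" "V \<noteq> 0"
  shows "\<exists>k w. pure w \<and> V = ([:0, 1:] ^ k * w) * pstar ([:0, 1:] ^ k * w)"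
  using assms(2,3)
proof (induction "degree V" arbitrary: V rule: less_induct)
  case less
  show ?case
  proof (cases "poly V 0 = 0")
    case False
    then obtain w where "pure w \<and> V = w * pstar w"
      using even_poly_norm_pure[OF two less.prems(1)] by blast
    then show ?thesis by (intro exI[of _ 0] exI[of _ w]) simp
  next
    case True
    then obtain U where U: "V = [:0, 1:] * U" by (metis dvdE poly_eq_0_iff_dvd minus_zero)
    have "[:0, 1:] * (- pstar U) = [:0, 1:] * U"
      using less.prems(1) unfolding U by (simp)
    then have sU: "- pstar U = U" by simp
    have "poly U 0 = - poly U 0" using arg_cong[OF sU, of "\<lambda>p. poly p 0"] by simp
    then have "2 * poly U 0 = 0" by (metis add.right_inverse mult_2)
    then have "poly U 0 = 0" using two by simp
    then obtain W where W: "U = [:0, 1:] * W" by (metis dvdE poly_eq_0_iff_dvd minus_zero)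
    have VW: "V = [:0, 1:] * [:0, 1:] * W" using U W by (simp add: mult.assoc)
    have "[:0, 1:] * pstar W = [:0, 1:] * W" using sU unfolding W by simp
    then have "pstar W = W" by simp
    moreover have "W \<noteq> 0" using less.prems VW by auto
    moreover have "degree W < degree V"
      using \<open>W \<noteq> 0\<close> unfolding U W by (auto simp: degree_mult_eq simp del: mult_pCons_left)
    ultimately obtain k w where w: "pure w" "W = ([:0, 1:] ^ k * w) * pstar ([:0, 1:] ^ k * w)"
      using less.hyps by blast
    obtain i :: 'a where i: "i ^ 2 = - 1" using nth_root_exists[of 2 "-1::'a"] by auto
    then have ii: "[:i:] * [:i:] = - 1" by (simp add: power2_eq_square one_pCons)
    have "i \<noteq> 0" using i by auto
    define v where "v = [:0, 1:] ^ Suc k * ([:i:] * w)"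
    have "v * pstar v = ([:i:] * [:i:]) * ([:0, 1:] * [:0, -1:]) * W"
      by (simp add: v_def w ac_simps)
    also have "\<dots> = V" unfolding VW ii by simp
    finally have "V = v * pstar v" by simp
    moreover have "pure ([:i:] * w)" using w \<open>i \<noteq> 0\<close> by simp
    ultimately show ?thesis unfolding v_def by blast
  qed
qed

section \<open>Matrices and sesquilinear forms\<close>

lemma invertible_mat_iff_det:
  fixes A :: "'a::comm_ring_1 mat"
  assumes A: "A \<in> carrier_mat n n"
  shows "invertible_mat A \<longleftrightarrow> det A dvd 1"
proof
  assume "invertible_mat A"
  then obtain B where AB: "A * B = 1\<^sub>m (dim_row A)" and BA: "B * A = 1\<^sub>m (dim_row B)"
    by (auto simp: invertible_mat_def inverts_mat_def)
  have "dim_col B = n" using arg_cong[OF AB, of dim_col] A by simp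
  moreover have "dim_row B = n" using arg_cong[OF BA, of dim_col] A by simp
  ultimately have B: "B \<in> carrier_mat n n" by auto
  have "1 = det A * det B" using det_mult[OF A B] AB A by simp
  then show "det A dvd 1" by (rule dvdI)
next
  assume "det A dvd 1"
  then obtain c where c: "1 = det A * c" by (elim dvdE)
  note adj = adj_mat[OF A]
  have 1: "c \<cdot>\<^sub>m (det A \<cdot>\<^sub>m 1\<^sub>m n) = 1\<^sub>m n"
    using c by (intro eq_matI) (auto simp: mult.commute)
  have "A * (c \<cdot>\<^sub>m adj_mat A) = 1\<^sub>m n"
    using mult_smult_distrib[OF A adj(1), of c] adj(2) 1 by simp
  moreover have "(c \<cdot>\<^sub>m adj_mat A) * A = 1\<^sub>m n"
    using mult_smult_assoc_mat[OF adj(1) A, of c] adj(3) 1 by simp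
  ultimately show "invertible_mat A"
    unfolding invertible_mat_def inverts_mat_def using A adj(1)
    by (auto intro!: exI[of _ "c \<cdot>\<^sub>m adj_mat A"])
qed

lemma invertible_mat_obtain:
  fixes A :: "'a::comm_ring_1 mat"
  assumes "invertible_mat A" and A: "A \<in> carrier_mat n n"
  obtains B where "B \<in> carrier_mat n n" "A * B = 1\<^sub>m n" "B * A = 1\<^sub>m n"
proof -
  obtain B where AB: "A * B = 1\<^sub>m (dim_row A)" and BA: "B * A = 1\<^sub>m (dim_row B)"
    using assms(1) by (auto simp: invertible_mat_def inverts_mat_def)
  have "dim_col B = n" using arg_cong[OF AB, of dim_col] A by simp
  moreover have "dim_row B = n" using arg_cong[OF BA, of dim_col] A by simp
  ultimately have "B \<in> carrier_mat n n" by auto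
  then show ?thesis using that[of B] AB BA A by auto
qed

lemma invertible_matI:
  fixes A :: "'a::comm_ring_1 mat"
  assumes "A \<in> carrier_mat n n" "B \<in> carrier_mat n n" "A * B = 1\<^sub>m n"
  shows "invertible_mat A"
  using det_mult[OF assms(1,2)] assms(3) invertible_mat_iff_det[OF assms(1)] by (metis det_one dvdI)

lemma invertible_mat_mult:
  fixes A B :: "'a::comm_ring_1 mat"
  assumes "A \<in> carrier_mat n n" "B \<in> carrier_mat n n" "invertible_mat A" "invertible_mat B"
  shows "invertible_mat (A * B)"
  using assms is_unit_mult_iff[of "det A" "det B"]
  by (simp add: invertible_mat_iff_det[of _ n] det_mult[of _ n])

lemma invertible_one_mat [simp]: "invertible_mat (1\<^sub>m n :: 'a::comm_ring_1 mat)"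
  by (simp add: invertible_mat_iff_det[of _ n])

lemma invertible_four_block_mat:
  fixes A :: "'a::idom mat"
  assumes "A \<in> carrier_mat k k" "D \<in> carrier_mat m m" "B \<in> carrier_mat k m"
    and "invertible_mat A" "invertible_mat D"
  shows "invertible_mat (four_block_mat A B (0\<^sub>m m k) D)"
  using assms det_four_block_mat_lower_left_zero[OF assms(1,3) refl assms(2)]
  by (simp add: invertible_mat_iff_det[of _ "k + m"] invertible_mat_iff_det[of A k]
      invertible_mat_iff_det[of D m])

lemma index_mult_sum:
  assumes "A \<in> carrier_mat n m" "B \<in> carrier_mat m l" "i < n" "j < l"
  shows "(A * B) $$ (i, j) = (\<Sum>k<m. A $$ (i, k) * B $$ (k, j))"
  using assms by (auto simp: scalar_prod_def atLeast0LessThan)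

lemma mat_star_carrier [simp]: "A \<in> carrier_mat n m \<Longrightarrow> mat_star A \<in> carrier_mat m n"
  by (auto simp: mat_star_def)

lemma dim_mat_star [simp]: "dim_row (mat_star A) = dim_col A" "dim_col (mat_star A) = dim_row A"
  by (auto simp: mat_star_def)

lemma index_mat_star [simp]:
  "i < dim_col A \<Longrightarrow> j < dim_row A \<Longrightarrow> mat_star A $$ (i, j) = pstar (A $$ (j, i))"
  by (simp add: mat_star_def)

lemma mat_star_mult:
  assumes "A \<in> carrier_mat n m" "B \<in> carrier_mat m l"
  shows "mat_star (A * B) = mat_star B * mat_star A"
  using assms by (intro eq_matI) (auto simp: scalar_prod_def mult.commute)

lemma mat_star_one [simp]: "mat_star (1\<^sub>m n) = 1\<^sub>m n"
  by (rule eq_matI) auto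

lemma invertible_mat_star:
  assumes "S \<in> carrier_mat n n" "invertible_mat S"
  shows "invertible_mat (mat_star S)"
proof -
  obtain T where T: "T \<in> carrier_mat n n" "T * S = 1\<^sub>m n"
    using assms by (metis invertible_mat_obtain)
  then have "mat_star S * mat_star T = 1\<^sub>m n" using mat_star_mult[OF T(1) assms(1)] by simp
  then show ?thesis using assms T by (intro invertible_matI[of _ n "mat_star T"]) auto
qed

section \<open>Congruence and direct sums of square matrices\<close>

lemma congruent_refl: "A \<in> carrier_mat n n \<Longrightarrow> congruent_mat n A A"
  unfolding congruent_mat_def by (rule bexI[of _ "1\<^sub>m n"]) auto

lemma congruent_trans:
  assumes A: "A \<in> carrier_mat n n" and "congruent_mat n A B" "congruent_mat n B C"
  shows "congruent_mat n A C"
proof -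
  obtain S T where S: "S \<in> carrier_mat n n" "invertible_mat S" "B = mat_star S * A * S"
    and T: "T \<in> carrier_mat n n" "invertible_mat T" "C = mat_star T * B * T"
    using assms(2,3) by (auto simp: congruent_mat_def)
  have "C = mat_star (S * T) * A * (S * T)"
    unfolding S T mat_star_mult[OF S(1) T(1)] using S(1) T(1) A
    by (simp add: assoc_mult_mat[of _ n n _ n _ n] mult_carrier_mat[of _ n n _ n])
  then show ?thesis unfolding congruent_mat_def
    using S T invertible_mat_mult[OF S(1) T(1)] by (intro bexI[of _ "S * T"]) auto
qed

definition dsum :: "'a::zero mat \<Rightarrow> 'a mat \<Rightarrow> 'a mat" where
  "dsum A D = four_block_mat A (0\<^sub>m (dim_row A) (dim_col D)) (0\<^sub>m (dim_row D) (dim_col A)) D"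

lemma dsum_carrier [simp]:
  "A \<in> carrier_mat k k \<Longrightarrow> D \<in> carrier_mat m m \<Longrightarrow> dsum A D \<in> carrier_mat (k + m) (k + m)"
  by (simp add: dsum_def)

lemma dsum_mult:
  fixes A :: "'a::semiring_0 mat"
  assumes "A \<in> carrier_mat k k" "B \<in> carrier_mat k k" "C \<in> carrier_mat m m" "D \<in> carrier_mat m m"
  shows "dsum A C * dsum B D = dsum (A * B) (C * D)"
proof -
  have "dsum A C * dsum B D = four_block_mat (A * B + 0\<^sub>m k m * 0\<^sub>m m k) (A * 0\<^sub>m k m + 0\<^sub>m k m * D)
    (0\<^sub>m m k * B + C * 0\<^sub>m m k) (0\<^sub>m m k * 0\<^sub>m k m + C * D)"
    using assms unfolding dsum_def by (simp add: mult_four_block_mat[of _ k k _ m _ m _ _ k _ m])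
  then show ?thesis using assms by (simp add: dsum_def)
qed

lemma dsum_star:
  assumes "A \<in> carrier_mat k k" "D \<in> carrier_mat m m"
  shows "mat_star (dsum A D) = dsum (mat_star A) (mat_star D)"
  using assms by (intro eq_matI) (auto simp: mat_star_def dsum_def)

lemma invertible_dsum:
  fixes A :: "'a::idom mat"
  assumes "A \<in> carrier_mat k k" "D \<in> carrier_mat m m" "invertible_mat A" "invertible_mat D"
  shows "invertible_mat (dsum A D)"
  using assms by (simp add: dsum_def invertible_four_block_mat[of A k D m])

lemma congruent_dsum:
  fixes A :: "'a::idom poly mat"
  assumes A: "A \<in> carrier_mat k k" and D: "D \<in> carrier_mat m m"
    and "congruent_mat k A A'" "congruent_mat m D D'"
  shows "congruent_mat (k + m) (dsum A D) (dsum A' D')"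
proof -
  obtain S T where S: "S \<in> carrier_mat k k" "invertible_mat S" "A' = mat_star S * A * S"
    and T: "T \<in> carrier_mat m m" "invertible_mat T" "D' = mat_star T * D * T"
    using assms(3,4) by (auto simp: congruent_mat_def)
  have "dsum A' D' = mat_star (dsum S T) * dsum A D * dsum S T"
    unfolding S T dsum_star[OF S(1) T(1)] using S(1) T(1) A D
    by (simp add: dsum_mult[of _ k _ _ m] mult_carrier_mat[of _ k k _ k] mult_carrier_mat[of _ m m _ m])
  then show ?thesis unfolding congruent_mat_def
    using S T invertible_dsum[OF S(1) T(1)] by (intro bexI[of _ "dsum S T"]) auto
qed

lemma congruent_smult:
  assumes A: "A \<in> carrier_mat n n" and "congruent_mat n A B"
  shows "congruent_mat n (f \<cdot>\<^sub>m A) (f \<cdot>\<^sub>m B)"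
proof -
  obtain S where S: "S \<in> carrier_mat n n" "invertible_mat S" "B = mat_star S * A * S"
    using assms(2) by (auto simp: congruent_mat_def)
  have "f \<cdot>\<^sub>m B = mat_star S * (f \<cdot>\<^sub>m A) * S" unfolding S(3) using S(1) A
    by (simp add: mult_smult_distrib[of _ n n _ n] mult_smult_assoc_mat[of _ n n _ n] mult_carrier_mat[of _ n n _ n])
  then show ?thesis using S unfolding congruent_mat_def by blast
qed

lemma smult_dsum: "f \<cdot>\<^sub>m dsum A D = dsum (f \<cdot>\<^sub>m A) (f \<cdot>\<^sub>m D)" for f :: "'a::comm_ring_1"
  by (rule eq_matI) (auto simp: dsum_def)

text \<open>Vectors are functions on the naturals of which only the values below the dimension
  matter, so that sums and multiples of vectors are plain lambda terms. The form is conjugate-linear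
  in its first argument.\<close>

definition hform :: "'a::comm_ring_1 poly mat \<Rightarrow> (nat \<Rightarrow> 'a poly) \<Rightarrow> (nat \<Rightarrow> 'a poly) \<Rightarrow> 'a poly" where
  "hform A x y = (\<Sum>i<dim_row A. \<Sum>j<dim_col A. pstar (x i) * A $$ (i, j) * y j)"

lemma hform_add_left [simp]: "hform A (\<lambda>i. x i + y i) z = hform A x z + hform A y z"
  and hform_add_right [simp]: "hform A z (\<lambda>i. x i + y i) = hform A z x + hform A z y"
  and hform_diff_left [simp]: "hform A (\<lambda>i. x i - y i) z = hform A x z - hform A y z"
  and hform_diff_right [simp]: "hform A z (\<lambda>i. x i - y i) = hform A z x - hform A z y"
  by (simp_all add: hform_def algebra_simps sum.distrib sum_subtractf)

lemma hform_scale_left [simp]: "hform A (\<lambda>i. c * x i) z = pstar c * hform A x z"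
  and hform_scale_right [simp]: "hform A z (\<lambda>i. c * x i) = c * hform A z x"
  by (simp_all add: hform_def sum_distrib_left ac_simps)

lemma hform_smult: "hform (f \<cdot>\<^sub>m A) x y = f * hform A x y"
  by (simp add: hform_def sum_distrib_left ac_simps)

lemma hform_cong:
  assumes "A \<in> carrier_mat n n" "\<And>i. i < n \<Longrightarrow> x i = x' i" "\<And>i. i < n \<Longrightarrow> y i = y' i"
  shows "hform A x y = hform A x' y'"
  using assms by (auto simp: hform_def intro!: sum.cong)

lemma hform_unit:
  assumes "A \<in> carrier_mat n n" "i < n" "j < n"
  shows "hform A (\<lambda>k. if k = i then 1 else 0) (\<lambda>k. if k = j then 1 else 0) = A $$ (i, j)"
proof -
  have "hform A (\<lambda>k. if k = i then 1 else 0) (\<lambda>k. if k = j then 1 else 0)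
    = (\<Sum>k<n. \<Sum>l<n. if l = j then (if k = i then A $$ (k, l) else 0) else 0)"
    unfolding hform_def using assms by (intro sum.cong) auto
  then show ?thesis using assms by simp
qed

lemma sum_smult: "(\<Sum>i\<in>I. Polynomial.smult c (f i)) = Polynomial.smult c (\<Sum>i\<in>I. f i)"
  by (induction I rule: infinite_finite_induct) (simp_all add: smult_add_right)

lemma hform_hermitian:
  assumes A: "A \<in> carrier_mat n n" and herm: "mat_star A = map_mat (Polynomial.smult e) A"
  shows "Polynomial.smult e (hform A y x) = pstar (hform A x y)"
proof -
  have "pstar (A $$ (i, j)) = Polynomial.smult e (A $$ (j, i))" if "i < n" "j < n" for i j
    using arg_cong[OF herm, of "\<lambda>M. M $$ (j, i)"] A that by simp
  then have "pstar (hform A x y) = (\<Sum>i<n. \<Sum>j<n. x i * Polynomial.smult e (A $$ (j, i)) * pstar (y j))"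
    using A by (auto simp: hform_def intro!: sum.cong)
  also have "\<dots> = (\<Sum>j<n. \<Sum>i<n. Polynomial.smult e (pstar (y j) * A $$ (j, i) * x i))"
    by (subst sum.swap) (simp add: ac_simps)
  also have "\<dots> = Polynomial.smult e (hform A y x)"
    using A by (simp add: hform_def sum_smult)
  finally show ?thesis by simp
qed

text \<open>This turns the search for a congruence into the choice of a basis, namely the columns of
  \<open>S\<close>.\<close>

lemma index_congruent:
  assumes A: "A \<in> carrier_mat n n" and S: "S \<in> carrier_mat n m" and ij: "i < m" "j < m"
  shows "(mat_star S * A * S) $$ (i, j) = hform A (\<lambda>k. S $$ (k, i)) (\<lambda>k. S $$ (k, j))"
proof -
  have "(mat_star S * A * S) $$ (i, j) = (\<Sum>l<n. (\<Sum>k<n. pstar (S $$ (k, i)) * A $$ (k, l)) * S $$ (l, j))"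
  proof (subst index_mult_sum[of _ m n _ m])
    show "mat_star S * A \<in> carrier_mat m n" using A S by (simp add: mult_carrier_mat[of _ m n _ n])
    have "(mat_star S * A) $$ (i, l) = (\<Sum>k<n. pstar (S $$ (k, i)) * A $$ (k, l))" if "l < n" for l
      using A S ij that by (subst index_mult_sum[of _ m n _ n]) auto
    then show "(\<Sum>l<n. (mat_star S * A) $$ (i, l) * S $$ (l, j))
      = (\<Sum>l<n. (\<Sum>k<n. pstar (S $$ (k, i)) * A $$ (k, l)) * S $$ (l, j))"
      by (intro sum.cong) auto
  qed (use S ij in auto)
  also have "\<dots> = hform A (\<lambda>k. S $$ (k, i)) (\<lambda>k. S $$ (k, j))"
    using A unfolding hform_def sum_distrib_right by (subst sum.swap) simp
  finally show ?thesis .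
qed

section \<open>Completing columns to a basis\<close>

definition mat22 :: "'a \<Rightarrow> 'a \<Rightarrow> 'a \<Rightarrow> 'a \<Rightarrow> 'a mat" where
  "mat22 a b c d = mat 2 2 (\<lambda>(i, j). if i = 0 then if j = 0 then a else b else if j = 0 then c else d)"

lemma mat22_carrier [simp]: "mat22 a b c d \<in> carrier_mat 2 2"
  by (simp add: mat22_def)

lemma eq_mat22I:
  assumes "A \<in> carrier_mat 2 2" "A $$ (0, 0) = a" "A $$ (0, 1) = b" "A $$ (1, 0) = c" "A $$ (1, 1) = d"
  shows "A = mat22 a b c d"
proof (rule eq_matI)
  fix i j assume "i < dim_row (mat22 a b c d)" "j < dim_col (mat22 a b c d)"
  then have "i = 0 \<or> i = 1" "j = 0 \<or> j = 1" by (auto simp: mat22_def)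
  then show "A $$ (i, j) = mat22 a b c d $$ (i, j)" using assms by (auto simp: mat22_def)
qed (use assms in \<open>auto simp: mat22_def\<close>)

lemma mat22_mult:
  fixes a b c d :: "'a::comm_ring_1"
  shows "mat22 a b c d * mat22 a' b' c' d' = mat22 (a * a' + b * c') (a * b' + b * d') (c * a' + d * c') (c * b' + d * d')"
  by (rule eq_mat22I) (auto simp: mat22_def scalar_prod_def numeral_2_eq_2)

lemma mat_star_mat22: "mat_star (mat22 a b c d) = mat22 (pstar a) (pstar c) (pstar b) (pstar d)"
  by (rule eq_mat22I) (auto simp: mat22_def)

lemma invertible_mat22:
  fixes a b c d :: "'a::comm_ring_1"
  assumes "(a * d - b * c) * k = 1"
  shows "invertible_mat (mat22 a b c d)"
proof (rule invertible_matI)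
  show "mat22 a b c d * mat22 (d * k) (- b * k) (- c * k) (a * k) = 1\<^sub>m 2"
    unfolding mat22_mult using assms
    by (intro eq_mat22I[symmetric]) (auto simp: algebra_simps)
qed auto

text \<open>Induction: the tail is \<open>g\<close> times a column of an invertible matrix, and a 2
  x 2 matrix of determinant one merges \<open>g\<close> with the leading entry into their common
  factor \<open>h\<close>.\<close>

lemma column_completion:
  fixes v :: "nat \<Rightarrow> 'a::field poly"
  shows "\<exists>S g. S \<in> carrier_mat (Suc n) (Suc n) \<and> invertible_mat S \<and> (\<forall>i\<le>n. v i = S $$ (i, 0) * g)"
proof (induction n arbitrary: v)
  case 0
  show ?case by (intro exI[of _ "1\<^sub>m 1"] exI[of _ "v 0"]) auto
next
  case (Suc m)
  obtain S g where S: "S \<in> carrier_mat (Suc m) (Suc m)" "invertible_mat S"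
    and v: "\<forall>i\<le>m. v (Suc i) = S $$ (i, 0) * g" using Suc[of "\<lambda>i. v (Suc i)"] by blast
  obtain h \<alpha> \<beta> \<gamma> \<delta> where h: "v 0 = h * \<alpha>" "g = h * \<beta>" and det: "\<alpha> * \<delta> - \<beta> * \<gamma> = 1"
    by (rule gcd_decomposition)
  define M where "M = mat22 \<alpha> \<gamma> \<beta> \<delta>"
  have M: "M \<in> carrier_mat 2 2" "invertible_mat M"
    using invertible_mat22[of \<alpha> \<delta> \<gamma> \<beta> 1] det by (auto simp: M_def mult.commute)
  define T where "T = dsum (1\<^sub>m 1) S"
  define E where "E = dsum M (1\<^sub>m m)"
  have T: "T \<in> carrier_mat (Suc (Suc m)) (Suc (Suc m))" "invertible_mat T"
    using dsum_carrier[of "1\<^sub>m 1" 1 S "Suc m"] invertible_dsum[of "1\<^sub>m 1" 1 S "Suc m"] S by (auto simp: T_def)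
  have E: "E \<in> carrier_mat (Suc (Suc m)) (Suc (Suc m))" "invertible_mat E"
    using dsum_carrier[of M 2 "1\<^sub>m m" m] invertible_dsum[of M 2 "1\<^sub>m m" m] M by (auto simp: E_def)
  have "v i = (T * E) $$ (i, 0) * h" if "i \<le> Suc m" for i
  proof -
    have "(T * E) $$ (i, 0) = (\<Sum>k<Suc (Suc m). T $$ (i, k) * E $$ (k, 0))"
      using that by (intro index_mult_sum[OF T(1) E(1)]) auto
    also have "\<dots> = T $$ (i, 0) * E $$ (0, 0) + T $$ (i, 1) * E $$ (1, 0)"
      unfolding sum.lessThan_Suc_shift using M by (auto simp: E_def dsum_def intro!: sum.neutral)
    also have "\<dots> * h = v i"
      using that S v h M by (cases i) (auto simp: E_def T_def dsum_def M_def mat22_def ac_simps)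
    finally show ?thesis ..
  qed
  then show ?case using T E invertible_mat_mult[OF T(1) E(1)] mult_carrier_mat[OF T(1) E(1)]
    by (intro exI[of _ "T * E"] exI[of _ h]) auto
qed

text \<open>The relation forces the factor \<open>g\<close> of the column completion to be a unit,
  which is then moved into the first column.\<close>

lemma unimodular_column:
  fixes v r :: "nat \<Rightarrow> 'a::field poly"
  assumes "(\<Sum>i<n. r i * v i) = 1"
  shows "\<exists>S \<in> carrier_mat n n. invertible_mat S \<and> (\<forall>i<n. S $$ (i, 0) = v i)"
proof -
  have "n \<noteq> 0" using assms by (intro notI) simp
  then obtain m where n: "n = Suc m" by (cases n) auto
  obtain S g where S: "S \<in> carrier_mat n n" "invertible_mat S" and v: "\<forall>i<n. v i = S $$ (i, 0) * g"
    using column_completion[of m v] unfolding n less_Suc_eq_le by auto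
  have "1 = g * (\<Sum>i<n. r i * S $$ (i, 0))"
    unfolding assms[symmetric] sum_distrib_left using v by (intro sum.cong) auto
  then have "g dvd 1" by (rule dvdI)
  define E where "E = dsum (mat 1 1 (\<lambda>_. g)) (1\<^sub>m m)"
  have g: "invertible_mat (mat 1 1 (\<lambda>_. g))"
    using \<open>g dvd 1\<close> invertible_mat_iff_det[of "mat 1 1 (\<lambda>_. g)" 1] det_single[of "mat 1 1 (\<lambda>_. g)"] by simp
  have E: "E \<in> carrier_mat n n" "invertible_mat E"
    using dsum_carrier[of "mat 1 1 (\<lambda>_. g)" 1 "1\<^sub>m m" m] invertible_dsum[of "mat 1 1 (\<lambda>_. g)" 1 "1\<^sub>m m" m] g
    by (auto simp: E_def n)
  have "(S * E) $$ (i, 0) = v i" if "i < n" for i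
  proof -
    have "(S * E) $$ (i, 0) = (\<Sum>k<n. S $$ (i, k) * E $$ (k, 0))"
      using that by (intro index_mult_sum[OF S(1) E(1)]) auto
    also have "\<dots> = S $$ (i, 0) * E $$ (0, 0)"
      unfolding n sum.lessThan_Suc_shift by (auto simp: E_def dsum_def intro!: sum.neutral)
    also have "\<dots> = v i" using v that by (auto simp: E_def dsum_def)
    finally show ?thesis .
  qed
  then show ?thesis using S E invertible_mat_mult[OF S(1) E(1)] mult_carrier_mat[OF S(1) E(1)]
    by (intro bexI[of _ "S * E"]) auto
qed

text \<open>The functional \<open>s\<close> kills \<open>v\<close>. After a change of basis that
  puts \<open>v\<close> first, it therefore certifies that the remaining coordinates of
  \<open>w\<close> are unimodular.\<close>

lemma unimodular_two_columns:
  fixes v w r s :: "nat \<Rightarrow> 'a::field poly"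
  assumes rv: "(\<Sum>i<n. r i * v i) = 1" and sv: "(\<Sum>i<n. s i * v i) = 0" and sw: "(\<Sum>i<n. s i * w i) = 1"
  shows "\<exists>S \<in> carrier_mat n n. invertible_mat S \<and> (\<forall>i<n. S $$ (i, 0) = v i) \<and> (\<forall>i<n. S $$ (i, 1) = w i)"
proof -
  obtain S where S: "S \<in> carrier_mat n n" "invertible_mat S" and v: "\<forall>i<n. S $$ (i, 0) = v i"
    using unimodular_column[OF rv] by auto
  obtain S' where S': "S' \<in> carrier_mat n n" "S * S' = 1\<^sub>m n" by (metis S invertible_mat_obtain)
  have "n \<noteq> 0" using rv by (intro notI) simp
  then obtain m where n: "n = Suc m" by (cases n) auto
  define w' where "w' k = (\<Sum>j<n. S' $$ (k, j) * w j)" for k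
  have w: "w i = (\<Sum>k<n. S $$ (i, k) * w' k)" if "i < n" for i
  proof -
    have "(\<Sum>k<n. S $$ (i, k) * w' k) = (\<Sum>j<n. (\<Sum>k<n. S $$ (i, k) * S' $$ (k, j)) * w j)"
      unfolding w'_def sum_distrib_left sum_distrib_right by (subst sum.swap) (simp add: mult.assoc)
    also have "\<dots> = (\<Sum>j<n. if j = i then w j else 0)"
    proof (intro sum.cong refl)
      fix j assume "j \<in> {..<n}"
      then have "(\<Sum>k<n. S $$ (i, k) * S' $$ (k, j)) = 1\<^sub>m n $$ (i, j)"
        using index_mult_sum[OF S(1) S'(1) that, of j] unfolding S'(2) by simp
      then show "(\<Sum>k<n. S $$ (i, k) * S' $$ (k, j)) * w j = (if j = i then w j else 0)"
        using that \<open>j \<in> {..<n}\<close> by simp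
    qed
    finally show ?thesis using that by simp
  qed
  \<comment> \<open>This is \<open>s\<close> in the coordinates of the new basis; its first
    coefficient is s(v) = 0, which drops \<open>w' 0\<close> from the relation.\<close>
  define s' where "s' k = (\<Sum>i<n. s i * S $$ (i, k))" for k
  have "s' 0 = 0" using sv v by (simp add: s'_def)
  have "(\<Sum>k<n. s' k * w' k) = (\<Sum>i<n. s i * w i)"
    unfolding s'_def sum_distrib_right by (subst sum.swap) (simp add: w sum_distrib_left mult.assoc)
  then have "(\<Sum>k<m. s' (Suc k) * w' (Suc k)) = 1"
    using \<open>s' 0 = 0\<close> sw unfolding n sum.lessThan_Suc_shift by simp
  then obtain U where U: "U \<in> carrier_mat m m" "invertible_mat U" and Uw: "\<forall>i<m. U $$ (i, 0) = w' (Suc i)"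
    using unimodular_column[where n = m and r = "\<lambda>k. s' (Suc k)" and v = "\<lambda>k. w' (Suc k)"] by blast
  have "m \<noteq> 0" using \<open>(\<Sum>k<m. s' (Suc k) * w' (Suc k)) = 1\<close> by (intro notI) simp
  \<comment> \<open>The first column of \<open>S\<close> is left alone, and the second column of
    \<open>T\<close> is \<open>w'\<close>: the entry \<open>w' 0\<close> above, the rest from
    \<open>U\<close>.\<close>
  define T where "T = four_block_mat (1\<^sub>m 1) (mat 1 m (\<lambda>_. w' 0)) (0\<^sub>m m 1) U"
  have T: "T \<in> carrier_mat n n" "invertible_mat T"
    using invertible_four_block_mat[of "1\<^sub>m 1" 1 U m "mat 1 m (\<lambda>_. w' 0)"]
      four_block_carrier_mat[of "1\<^sub>m 1" 1 1 U m m] U by (auto simp: T_def n)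
  have "(S * T) $$ (i, 0) = v i" if "i < n" for i
  proof -
    have "(S * T) $$ (i, 0) = (\<Sum>k<n. S $$ (i, k) * T $$ (k, 0))"
      using that by (intro index_mult_sum[OF S(1) T(1)]) auto
    also have "\<dots> = S $$ (i, 0)"
      unfolding n sum.lessThan_Suc_shift using U by (auto simp: T_def intro!: sum.neutral)
    finally show ?thesis using v that by auto
  qed
  moreover have "(S * T) $$ (i, 1) = w i" if "i < n" for i
  proof -
    have "(S * T) $$ (i, 1) = (\<Sum>k<n. S $$ (i, k) * T $$ (k, 1))"
      using that \<open>m \<noteq> 0\<close> n by (intro index_mult_sum[OF S(1) T(1)]) auto
    also have "\<dots> = (\<Sum>k<n. S $$ (i, k) * w' k)"
      unfolding n sum.lessThan_Suc_shift using U Uw \<open>m \<noteq> 0\<close> by (auto simp: T_def)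
    finally show ?thesis using w that by auto
  qed
  ultimately show ?thesis using S T invertible_mat_mult[OF S(1) T(1)] mult_carrier_mat[OF S(1) T(1)]
    by (intro bexI[of _ "S * T"]) auto
qed

text \<open>The matrix of these column operations is unitriangular, hence of determinant
  one.\<close>

lemma column_elimination:
  fixes S :: "'a::idom mat"
  assumes S: "S \<in> carrier_mat n n" "invertible_mat S" and "k \<le> n"
  shows "\<exists>S' \<in> carrier_mat n n. invertible_mat S' \<and>
    (\<forall>i<n. \<forall>j<n. S' $$ (i, j) = (if j < k then S $$ (i, j) else S $$ (i, j) + (\<Sum>l<k. S $$ (i, l) * C l j)))"
proof -
  define T where "T = mat n n (\<lambda>(l, j). if l = j then 1 else if l < k \<and> k \<le> j then C l j else 0)"
  have T: "T \<in> carrier_mat n n" by (simp add: T_def)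
  have "upper_triangular T" by (auto simp: T_def upper_triangular_def)
  then have "det T = prod_list (diag_mat T)" by (rule det_upper_triangular[OF _ T])
  also have "diag_mat T = map (\<lambda>_. 1) [0..<n]"
    unfolding diag_mat_def by (intro map_cong) (auto simp: T_def)
  finally have "det T = 1" by (simp add: map_replicate_const)
  then have iT: "invertible_mat T" using invertible_mat_iff_det[OF T] by simp
  have "(S * T) $$ (i, j) = (if j < k then S $$ (i, j) else S $$ (i, j) + (\<Sum>l<k. S $$ (i, l) * C l j))"
    if ij: "i < n" "j < n" for i j
  proof -
    have "(S * T) $$ (i, j) = (\<Sum>l<n. S $$ (i, l) * T $$ (l, j))"
      using that by (intro index_mult_sum[OF S(1) T]) auto
    also have "\<dots> = (\<Sum>l<n. (if l = j then S $$ (i, l) else 0) +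
        (if l \<in> {..<k} then if k \<le> j then S $$ (i, l) * C l j else 0 else 0))"
      using ij by (intro sum.cong) (auto simp: T_def)
    also have "\<dots> = S $$ (i, j) + (\<Sum>l\<in>{..<n} \<inter> {..<k}. if k \<le> j then S $$ (i, l) * C l j else 0)"
      unfolding sum.distrib sum.inter_restrict[OF finite_lessThan, symmetric] using ij by simp
    also have "{..<n} \<inter> {..<k} = {..<k}" using \<open>k \<le> n\<close> by auto
    finally show ?thesis by auto
  qed
  then show ?thesis using S T iT invertible_mat_mult[OF S(1) T] mult_carrier_mat[OF S(1) T]
    by (intro bexI[of _ "S * T"]) auto
qed

text \<open>Orthogonal projection: by \<open>proj\<close> every vector can be moved, by a
  combination of the first \<open>k\<close> columns, into the space annihilated by them. Such
  operations clear the upper right block, and symmetry clears the lower left one. The last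
  conclusion records that the entries of \<open>D\<close> are values on this complement, so that a
  divisibility proved there passes to \<open>D\<close>.\<close>

lemma split_off:
  fixes A S :: "'a::field poly mat"
  assumes A: "A \<in> carrier_mat (k + m) (k + m)" and herm: "mat_star A = map_mat (Polynomial.smult e) A"
    and e: "e = 1 \<or> e = -1"
    and S: "S \<in> carrier_mat (k + m) (k + m)" "invertible_mat S"
    and proj: "\<And>y. \<exists>c. \<forall>i<k. hform A (\<lambda>r. S $$ (r, i)) (\<lambda>r. y r + (\<Sum>l<k. S $$ (r, l) * c l)) = 0"
  shows "\<exists>D \<in> carrier_mat m m. mat_star D = map_mat (Polynomial.smult e) D \<and>
     congruent_mat (k + m) A (dsum (mat k k (\<lambda>(i, j). hform A (\<lambda>r. S $$ (r, i)) (\<lambda>r. S $$ (r, j)))) D) \<and>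
     (\<forall>i<m. \<forall>j<m. \<exists>y y'. D $$ (i, j) = hform A y y' \<and>
        (\<forall>l<k. hform A (\<lambda>r. S $$ (r, l)) y = 0 \<and> hform A (\<lambda>r. S $$ (r, l)) y' = 0))"
proof -
  have "\<exists>C. \<forall>j. \<forall>i<k.
    hform A (\<lambda>r. S $$ (r, i)) (\<lambda>r. S $$ (r, j) + (\<Sum>l<k. S $$ (r, l) * C j l)) = 0"
    by (intro choice allI proj)
  then obtain C where C: "\<And>j i. i < k \<Longrightarrow>
    hform A (\<lambda>r. S $$ (r, i)) (\<lambda>r. S $$ (r, j) + (\<Sum>l<k. S $$ (r, l) * C j l)) = 0"
    by blast
  obtain T where T: "T \<in> carrier_mat (k + m) (k + m)" "invertible_mat T"
    and Tij: "\<forall>i<k + m. \<forall>j<k + m. T $$ (i, j)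
      = (if j < k then S $$ (i, j) else S $$ (i, j) + (\<Sum>l<k. S $$ (i, l) * C j l))"
    using column_elimination[OF S, of k "\<lambda>l j. C j l"] by auto
  define B where "B = mat_star T * A * T"
  have B: "B \<in> carrier_mat (k + m) (k + m)"
    using A T by (simp add: B_def mult_carrier_mat[of _ "k + m" "k + m" _ "k + m"])
  have Bij: "B $$ (i, j) = hform A (\<lambda>r. T $$ (r, i)) (\<lambda>r. T $$ (r, j))" if "i < k + m" "j < k + m" for i j
    unfolding B_def using that by (rule index_congruent[OF A T(1)])
  have Tk: "hform A (\<lambda>r. S $$ (r, i)) (\<lambda>r. T $$ (r, j)) = 0" if "i < k" "k \<le> j" "j < k + m" for i j
    using C[of i j] that Tij by (subst hform_cong[OF A refl, of _ "\<lambda>r. S $$ (r, j) + (\<Sum>l<k. S $$ (r, l) * C j l)"]) auto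
  have TS: "hform A (\<lambda>r. T $$ (r, i)) y = hform A (\<lambda>r. S $$ (r, i)) y" if "i < k" for i y
    using that Tij by (intro hform_cong[OF A]) auto
  have TS': "hform A y (\<lambda>r. T $$ (r, i)) = hform A y (\<lambda>r. S $$ (r, i))" if "i < k" for i y
    using that Tij by (intro hform_cong[OF A]) auto
  have B_ur: "B $$ (i, j) = 0" if "i < k" "k \<le> j" "j < k + m" for i j
    using Bij[of i j] Tk[OF that] TS[of i] that by simp
  have sym: "Polynomial.smult e (hform A y x) = pstar (hform A x y)" for x y
    by (rule hform_hermitian[OF A herm])
  have B_herm: "Polynomial.smult e (B $$ (j, i)) = pstar (B $$ (i, j))" if "i < k + m" "j < k + m" for i j
    unfolding Bij[OF that] Bij[OF that(2,1)] by (rule sym)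
  have B_ll: "B $$ (j, i) = 0" if "i < k" "k \<le> j" "j < k + m" for i j
    using B_herm[of i j] B_ur[OF that] that e by auto
  define D where "D = mat m m (\<lambda>(i, j). B $$ (k + i, k + j))"
  have D: "D \<in> carrier_mat m m" by (simp add: D_def)
  have "B = dsum (mat k k (\<lambda>(i, j). hform A (\<lambda>r. S $$ (r, i)) (\<lambda>r. S $$ (r, j)))) D"
    using B B_ur B_ll Bij TS TS' by (intro eq_matI) (auto simp: dsum_def D_def)
  then have "congruent_mat (k + m) A (dsum (mat k k (\<lambda>(i, j). hform A (\<lambda>r. S $$ (r, i)) (\<lambda>r. S $$ (r, j)))) D)"
    unfolding congruent_mat_def B_def using T by metis
  moreover have "mat_star D = map_mat (Polynomial.smult e) D"
    using B_herm by (intro eq_matI) (auto simp: D_def mat_star_def)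
  moreover have "\<exists>y y'. D $$ (i, j) = hform A y y' \<and>
        (\<forall>l<k. hform A (\<lambda>r. S $$ (r, l)) y = 0 \<and> hform A (\<lambda>r. S $$ (r, l)) y' = 0)" if "i < m" "j < m" for i j
    using that Tk Bij[of "k + i" "k + j"]
    by (intro exI[of _ "\<lambda>r. T $$ (r, k + i)"] exI[of _ "\<lambda>r. T $$ (r, k + j)"]) (auto simp: D_def)
  ultimately show ?thesis using D by blast
qed

section \<open>Hermitian planes\<close>

text \<open>Supplies the free parameter of an isotropic vector. A linear r = 1 + l t suffices, as
  only finitely many \<open>l\<close> are bad.\<close>

lemma generic_linear_coprime:
  fixes a w :: "'a::alg_closed_field poly"
  assumes two: "(2::'a) \<noteq> 0" and "a \<noteq> 0" "w \<noteq> 0" and 0: "poly a 0 = 0 \<Longrightarrow> poly w 0 \<noteq> 1"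
  obtains r where "poly r 0 = 1" "coprime (a * r) (r - pstar w * pstar r)"
proof -
  \<comment> \<open>At a root x of \<open>a\<close> the second polynomial is linear in
    \<open>l\<close>. If the coefficient of \<open>l\<close> vanishes, then either x = 0 and the
    constant term 1 - w(0) is nonzero by hypothesis, or w(-x) = -1 and it is 2. So each root
    excludes at most one \<open>l\<close>.\<close>
  define bad where "bad x = {l. (1 - poly w (- x)) + l * (x * (1 + poly w (- x))) = 0}" for x
  have bad: "finite (bad x)" if "poly a x = 0" for x
  proof (cases "x * (1 + poly w (- x)) = 0")
    case True
    have "1 - poly w (- x) \<noteq> 0"
    proof (cases "x = 0")
      case True then show ?thesis using 0 that by simp
    next
      case False
      then have "poly w (- x) = - 1" using True by (simp add: add_eq_0_iff)
      then show ?thesis using two by simp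
    qed
    then have "bad x = {}" unfolding bad_def True by simp
    then show ?thesis by simp
  next
    case False
    have "l = - (1 - poly w (- x)) / (x * (1 + poly w (- x)))" if "l \<in> bad x" for l
      using that unfolding bad_def by (simp add: add_eq_0_iff nonzero_eq_divide_eq[OF False])
    then have "bad x \<subseteq> {- (1 - poly w (- x)) / (x * (1 + poly w (- x)))}" by auto
    then show ?thesis by (rule finite_subset) simp
  qed
  have "finite ((\<Union>x\<in>{x. poly a x = 0}. bad x) \<union> (\<lambda>x. 1 / x) ` {x. poly w x = 0})"
    using bad poly_roots_finite[OF \<open>a \<noteq> 0\<close>] poly_roots_finite[OF \<open>w \<noteq> 0\<close>] by simp
  then obtain l where l: "l \<notin> (\<Union>x\<in>{x. poly a x = 0}. bad x) \<union> (\<lambda>x. 1 / x) ` {x. poly w x = 0}"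
    using infinite_alg_closed ex_new_if_finite by blast
  define r where "r = [:1, l:]"
  have "coprime (a * r) (r - pstar w * pstar r)"
  proof (rule coprime_if_no_common_root)
    show "a * r \<noteq> 0" using \<open>a \<noteq> 0\<close> by (simp add: r_def del: mult_pCons_right)
  next
    fix x assume "poly (a * r) x = 0"
    then consider "poly a x = 0" | "poly r x = 0" by auto
    then show "poly (r - pstar w * pstar r) x \<noteq> 0"
    proof cases
      case 1
      then have "l \<notin> bad x" using l by auto
      then show ?thesis by (simp add: bad_def r_def algebra_simps)
    next
      \<comment> \<open>The root of \<open>r\<close> is -1/l, where \<open>pstar r\<close> takes the
        value 2; the excluded values of \<open>l\<close> keep \<open>w\<close> nonzero at
        1/l.\<close>
      case 2
      then have lx: "l * x = - 1" by (simp add: r_def eq_neg_iff_add_eq_0 add.commute mult.commute)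
      then have "l \<noteq> 0" by auto
      moreover from this lx have "- x = 1 / l" by (simp add: eq_divide_eq mult.commute)
      moreover have "poly w (1 / l) \<noteq> 0" using l by force
      ultimately show ?thesis using 2 lx two by (simp add: r_def mult.commute)
    qed
  qed
  then show ?thesis using that[of r] by (simp add: r_def)
qed

text \<open>For v = \<alpha> x + \<beta> y, completing the square gives e a h(v, v) = N(a \<alpha> +
  \<beta>) - N(w \<beta>), where a = h(x, x) and N(u) is u times its conjugate. The vector
  \<open>z\<close> makes the two arguments a w r and a w r*, which have the same norm. Coprimality
  of a r and r - w* r* then yields a combination of \<open>x\<close> and \<open>y\<close> that pairs
  with \<open>z\<close> to \<open>w\<close>. The relation between constant terms is what the
  Hermitian case needs at t = 0.\<close>

lemma isotropic_vector:
  fixes A :: "'a::alg_closed_field poly mat"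
  assumes two: "(2::'a) \<noteq> 0" and A: "A \<in> carrier_mat n n"
    and herm: "mat_star A = map_mat (Polynomial.smult e) A" and e: "e = 1 \<or> e = -1"
    and xy: "hform A x y = 1" and a: "hform A x x \<noteq> 0"
    and w: "w * pstar w = 1 - Polynomial.smult e (hform A x x * hform A y y)" "w \<noteq> 0"
    and w0: "poly (hform A x x) 0 = 0 \<Longrightarrow> poly w 0 \<noteq> 1"
  obtains z \<alpha> \<beta> where "hform A z z = 0"
    "hform A (\<lambda>i. \<alpha> * x i + \<beta> * y i) z = w"
    "poly w 0 = 0 \<Longrightarrow> poly (hform A x x) 0 * poly \<alpha> 0 + e * poly \<beta> 0 = 1"
proof -
  note sym = hform_hermitian[OF A herm]
  define a where "a = hform A x x"
  define c where "c = hform A y y"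
  have ax: "pstar a = Polynomial.smult e a" using sym[of x x] by (simp add: a_def)
  have "hform A y x = Polynomial.smult e (Polynomial.smult e (hform A y x))" using e by auto
  then have yx: "hform A y x = [:e:]" unfolding sym xy by simp
  obtain r where r0: "poly r 0 = 1" and "coprime (a * r) (r - pstar w * pstar r)"
    using generic_linear_coprime[OF two, of a w] assms(6) w w0 unfolding a_def by blast
  then obtain \<alpha> \<beta> where ab: "a * r * \<alpha> + (r - pstar w * pstar r) * \<beta> = 1"
    using coprime_bezout by blast
  \<comment> \<open>The isotropic lines of the plane correspond to the \<open>w\<close> of the given norm;
    replacing \<open>w\<close> by \<open>w r / r*\<close> does not change the norm.\<close>
  define z where "z i = (w * r - pstar r) * x i + (a * pstar r) * y i" for i
  have ee: "[:e:] * [:e:] = 1" using e by (auto simp: one_pCons)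
  have ca: "c * a = [:e:] * (1 - w * pstar w)" using e unfolding w a_def c_def
    by (auto simp: mult.commute)
  have xz: "hform A x z = a * w * r" unfolding z_def
    by (simp add: xy algebra_simps flip: a_def)
  have "hform A y z = [:e:] * (w * r - pstar r) + c * a * pstar r" unfolding z_def
    by (simp only: hform_add_right hform_scale_right yx c_def[symmetric]) (simp only: ac_simps)
  also have "\<dots> = [:e:] * (w * (r - pstar w * pstar r))"
    unfolding ca by (simp only: algebra_simps mult_1_left)
  finally have yz: "hform A y z = [:e:] * (w * (r - pstar w * pstar r))" .
  show ?thesis
  proof (rule that[of z "pstar \<alpha>" "[:e:] * pstar \<beta>"])
    have "hform A z v = pstar (w * r - pstar r) * hform A x v + pstar (a * pstar r) * hform A y v" for v
      unfolding z_def by simp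
    then have "hform A z z = pstar (w * r - pstar r) * hform A x z + pstar (a * pstar r) * hform A y z" .
    also have "\<dots> = (pstar w * pstar r - r) * (a * w * r) + ([:e:] * [:e:]) * (a * r * (w * (r - pstar w * pstar r)))"
      unfolding xz yz by (simp add: ax)
    also have "\<dots> = 0" unfolding ee by (simp add: algebra_simps)
    finally show "hform A z z = 0" .
    have "hform A (\<lambda>i. pstar \<alpha> * x i + ([:e:] * pstar \<beta>) * y i) z = \<alpha> * (a * w * r) + ([:e:] * [:e:]) * (\<beta> * (w * (r - pstar w * pstar r)))"
      by (simp only: hform_add_left hform_scale_left xz yz pstar_mult pstar_pstar pstar_const) (simp only: ac_simps)
    also have "\<dots> = w * (a * r * \<alpha> + (r - pstar w * pstar r) * \<beta>)" unfolding ee by (simp add: algebra_simps)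
    finally show "hform A (\<lambda>i. pstar \<alpha> * x i + ([:e:] * pstar \<beta>) * y i) z = w" unfolding ab by simp
    assume "poly w 0 = 0"
    then have "poly a 0 * poly \<alpha> 0 + poly \<beta> 0 = 1"
      using arg_cong[OF ab, of "\<lambda>p. poly p 0"] r0 by simp
    then show "poly (hform A x x) 0 * poly (pstar \<alpha>) 0 + e * poly ([:e:] * pstar \<beta>) 0 = 1"
      using e by (auto simp: a_def)
  qed
qed

text \<open>The odd polynomial \<open>a\<close> vanishes at 0, so \<open>1 + a * c\<close> is 1
  there and is the norm of a pure polynomial. If \<open>x\<close> is itself isotropic,
  \<open>y\<close> already pairs with it to 1.\<close>

lemma skew_isotropic_pure:
  fixes A :: "'a::alg_closed_field poly mat"
  assumes two: "(2::'a) \<noteq> 0" and A: "A \<in> carrier_mat n n"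
    and herm: "mat_star A = map_mat (Polynomial.smult (- 1)) A" and xy: "hform A x y = 1"
  obtains z v where "hform A z z = 0" "pure (hform A z v)"
proof (cases "hform A x x = 0")
  case True
  then show ?thesis using that[of x y] xy by (simp add: pure_def)
next
  case False
  note sym = hform_hermitian[OF A herm]
  define a where "a = hform A x x"
  define c where "c = hform A y y"
  have ac: "pstar a = - a" "pstar c = - c" using sym[of x x] sym[of y y] by (auto simp: a_def c_def)
  have "poly a 0 = - poly a 0" using arg_cong[OF ac(1), of "\<lambda>p. poly p 0"] by simp
  then have "2 * poly a 0 = 0" by (metis add.right_inverse mult_2)
  then have a0: "poly a 0 = 0" using two by simp
  have "pstar (1 + a * c) = 1 + a * c" "poly (1 + a * c) 0 \<noteq> 0" using ac a0 by auto
  then obtain v where v: "pure v" "1 + a * c = v * pstar v" using even_poly_norm_pure[OF two] by blast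
  have "poly v 0 ^ 2 = 1" using arg_cong[OF v(2), of "\<lambda>p. poly p 0"] a0 by (simp add: power2_eq_square)
  then have "poly v 0 = 1 \<or> poly v 0 = - 1" by (simp add: power2_eq_1_iff)
  \<comment> \<open>A norm does not see the sign, which is chosen so that \<open>w\<close> is not 1
    at 0, where \<open>a\<close> vanishes.\<close>
  define w where "w = (if poly v 0 = 1 then - v else v)"
  have w: "pure w" "w * pstar w = 1 + a * c" "poly w 0 \<noteq> 1"
    using v \<open>poly v 0 = 1 \<or> poly v 0 = - 1\<close> two pure_smult[of "- 1" v] by (auto simp: w_def)
  obtain z \<alpha> \<beta> where z: "hform A z z = 0" "hform A (\<lambda>i. \<alpha> * x i + \<beta> * y i) z = w"
    by (rule isotropic_vector[OF two A herm _ xy False, of w]) (use w in \<open>auto simp: a_def c_def pure_def\<close>)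
  have "pure (hform A z (\<lambda>i. \<alpha> * x i + \<beta> * y i))"
    using w(1) sym[of z "\<lambda>i. \<alpha> * x i + \<beta> * y i"] unfolding z(2)
    by (metis pure_pstar pure_smult neg_equal_0_iff_equal one_neq_zero)
  then show ?thesis using that z by blast
qed

lemma finite_root_avoid:
  fixes f g m :: "'a::alg_closed_field poly"
  assumes "m \<noteq> 0" and "\<And>x. poly m x = 0 \<Longrightarrow> poly g x \<noteq> 0"
  obtains l where "\<And>x. poly m x = 0 \<Longrightarrow> poly f x + l * poly g x \<noteq> 0"
proof -
  have "finite ((\<lambda>x. - poly f x / poly g x) ` {x. poly m x = 0})" using poly_roots_finite[OF assms(1)] by simp
  then obtain l where l: "l \<notin> (\<lambda>x. - poly f x / poly g x) ` {x. poly m x = 0}"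
    using infinite_alg_closed ex_new_if_finite by blast
  have "poly f x + l * poly g x \<noteq> 0" if x: "poly m x = 0" for x
  proof
    assume "poly f x + l * poly g x = 0"
    then have "l * poly g x = - poly f x" by (simp add: add_eq_0_iff)
    then have "l = - poly f x / poly g x" using assms(2)[OF x] by (metis nonzero_eq_divide_eq)
    then show False using l x by blast
  qed
  then show ?thesis by (rule that)
qed

text \<open>The corrections along \<open>z\<close> carry the factor s = t^(2k), so the multiple of
  \<open>X\<close> must already give c V = 1 modulo \<open>s\<close>. This is solvable because c(0)
  is nonzero when k > 0. The remaining quotient \<open>u\<close> is even and is met by a
  trace.\<close>

lemma hermitian_plane_represents_one:
  fixes A :: "'a::alg_closed_field poly mat"
  assumes two: "(2::'a) \<noteq> 0" and A: "A \<in> carrier_mat n n"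
    and herm: "mat_star A = map_mat (Polynomial.smult 1) A"
    and X: "hform A X z = [:0, 1:] ^ k * w" and w: "pure w" and z: "hform A z z = 0"
    and k: "k > 0 \<Longrightarrow> poly (hform A X X) 0 \<noteq> 0"
  obtains v where "hform A v v = 1"
proof -
  have sym: "hform A y x = pstar (hform A x y)" for x y using hform_hermitian[OF A herm, of y x] by simp
  define c where "c = hform A X X"
  have c: "pstar c = c" using sym[of X X] by (simp add: c_def)
  define s :: "'a poly" where "s = [:0, 1:] ^ k * [:0, 1:] ^ k"
  have s: "pstar s = s" unfolding s_def by (simp flip: power_mult_distrib)
  have w_nz: "w \<noteq> 0" using w by (simp add: pure_def)
  \<comment> \<open>If \<open>V = v v*\<close>, then \<open>v* X + t^k q z\<close> has value \<open>c V + s (v w q + (v w q)*)\<close>, and the trace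
    is an arbitrary even polynomial as soon as \<open>v w\<close> is pure.\<close>
  have "\<exists>V u. pstar V = V \<and> c * V + s * u = 1 \<and> poly V 0 \<noteq> 0 \<and> (\<forall>x. poly w x = 0 \<longrightarrow> poly V x \<noteq> 0)"
  proof (cases "k = 0")
    case True
    then show ?thesis by (intro exI[of _ 1] exI[of _ "1 - c"]) (simp add: s_def)
  next
    case False
    have s0: "poly s x = 0 \<longleftrightarrow> x = 0" for x using False by (simp add: s_def)
    have "coprime s c"
      by (rule coprime_if_no_common_root) (use k False s0 in \<open>auto simp: s_def c_def\<close>)
    then obtain y V where yV: "s * y + c * V = 1" by (rule coprime_bezout)
    then have yV': "s * pstar y + c * pstar V = 1" using s c by (metis pstar_1 pstar_add pstar_mult)
    \<comment> \<open>As \<open>s\<close> and \<open>c\<close> are even, averaging with the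
      conjugate makes the Bezout coefficient even and keeps the relation.\<close>
    define V0 where "V0 = [:1/2:] * (V + pstar V)"
    have "c * V0 + s * ([:1/2:] * (y + pstar y)) = [:1/2:] * (s * y + c * V) + [:1/2:] * (s * pstar y + c * pstar V)"
      by (simp only: V0_def distrib_left distrib_right ac_simps)
    then have V0: "c * V0 + s * ([:1/2:] * (y + pstar y)) = 1" unfolding yV yV' using two_half[OF two] by simp
    have V0s: "pstar V0 = V0" by (simp add: V0_def add.commute)
    have "poly s 0 = 0" using s0 by blast
    then have "poly V0 0 \<noteq> 0" using arg_cong[OF V0, of "\<lambda>p. poly p 0"] by (intro notI) simp
    have "poly s x \<noteq> 0" if "poly w x = 0" for x
    proof -
      have "x \<noteq> 0" using pure_root[OF w that] that by auto
      then show ?thesis using s0 by simp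
    qed
    \<comment> \<open>Adding a multiple of \<open>s\<close> to \<open>V0\<close> is compensated in
      the other coefficient and moves \<open>V\<close> off the roots of \<open>w\<close>. These are
      nonzero by purity, so \<open>s\<close> does not vanish there.\<close>
    then obtain l where l: "\<And>x. poly w x = 0 \<Longrightarrow> poly V0 x + l * poly s x \<noteq> 0"
      using finite_root_avoid[OF w_nz] by blast
    have "c * (V0 + [:l:] * s) + s * ([:1/2:] * (y + pstar y) - [:l:] * c)
      = c * V0 + s * ([:1/2:] * (y + pstar y))" by (simp only: algebra_simps)
    then have "c * (V0 + [:l:] * s) + s * ([:1/2:] * (y + pstar y) - [:l:] * c) = 1" unfolding V0 .
    moreover have "pstar (V0 + [:l:] * s) = V0 + [:l:] * s" using V0s s by simp
    moreover have "poly (V0 + [:l:] * s) 0 \<noteq> 0" using \<open>poly V0 0 \<noteq> 0\<close> \<open>poly s 0 = 0\<close> by simp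
    moreover have "\<forall>x. poly w x = 0 \<longrightarrow> poly (V0 + [:l:] * s) x \<noteq> 0" using l by simp
    ultimately show ?thesis by blast
  qed
  then obtain V u where V: "pstar V = V" "c * V + s * u = 1" "poly V 0 \<noteq> 0"
    "\<And>x. poly w x = 0 \<Longrightarrow> poly V x \<noteq> 0" by blast
  obtain v where v: "pure v" "V = v * pstar v" using even_poly_norm_pure[OF two V(1,3)] by blast
  have "c * V + s * pstar u = 1" using arg_cong[OF V(2), of pstar] V(1) s c by simp
  then have "s * pstar u = s * u" using V(2) by (metis add_left_cancel)
  then have us: "pstar u = Polynomial.smult 1 u" by (simp add: s_def)
  \<comment> \<open>No root of \<open>w\<close> is a root of V = v v*, so neither a root of
    \<open>v\<close> nor its negative is a root of \<open>w\<close>.\<close>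
  have "pure (v * w)"
  proof (rule pureI)
    show "v * w \<noteq> 0" using v w_nz by (simp add: pure_def)
  next
    fix x assume "poly (v * w) x = 0"
    then consider "poly v x = 0" | "poly w x = 0" by auto
    then show "poly (v * w) (- x) \<noteq> 0"
    proof cases
      case 1
      then have "poly V (- x) = 0" by (simp add: v)
      then have "poly w (- x) \<noteq> 0" using V(4) by blast
      then show ?thesis using pure_root[OF v(1) 1] by simp
    next
      case 2
      then have "poly V x \<noteq> 0" using V(4) by blast
      then show ?thesis using pure_root[OF w 2] by (simp add: v)
    qed
  qed
  then obtain q where q: "v * w * q + pstar (v * w) * pstar q = u"
    by (rule pure_trace_eq[OF two _ us]) simp
  define y where "y i = pstar v * X i + ([:0, 1:] ^ k * q) * z i" for i
  have "hform A y y = v * pstar v * c + (v * ([:0, 1:] ^ k * q) * ([:0, 1:] ^ k * w)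
    + pstar (v * ([:0, 1:] ^ k * q) * ([:0, 1:] ^ k * w)))"
    unfolding y_def using X z sym[of z X] by (simp flip: c_def)
  also have "v * ([:0, 1:] ^ k * q) * ([:0, 1:] ^ k * w) = s * (v * w * q)" by (simp only: s_def ac_simps)
  also have "v * pstar v * c + (s * (v * w * q) + pstar (s * (v * w * q))) = c * V + s * u"
    unfolding q[symmetric] v(2) pstar_mult s by (simp only: algebra_simps)
  finally show ?thesis using that[of y] V by simp
qed

text \<open>If \<open>a\<close> is 0, \<open>x\<close> is isotropic and pairs with \<open>y\<close>
  to 1. If the Gram determinant vanishes, \<open>a\<close> is a nonzero constant and
  \<open>x\<close> is rescaled by a square root. Otherwise an isotropic vector is built from a
  factor of the norm \<open>1 - a * c\<close>.\<close>

lemma hermitian_represents_one: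
  fixes A :: "'a::alg_closed_field poly mat"
  assumes two: "(2::'a) \<noteq> 0" and A: "A \<in> carrier_mat n n"
    and herm: "mat_star A = map_mat (Polynomial.smult 1) A" and xy: "hform A x y = 1"
  obtains v where "hform A v v = 1"
proof -
  have sym: "hform A y x = pstar (hform A x y)" for x y using hform_hermitian[OF A herm, of y x] by simp
  define a where "a = hform A x x"
  define c where "c = hform A y y"
  have ac: "pstar a = a" "pstar c = c" using sym[of x x] sym[of y y] by (simp_all add: a_def c_def)
  have yx: "hform A y x = 1" using sym[of y x] xy by simp
  consider "a = 0" | "a \<noteq> 0" "1 - a * c = 0" | "a \<noteq> 0" "1 - a * c \<noteq> 0" by blast
  then show ?thesis
  proof cases
    case 1
    show ?thesis
      by (rule hermitian_plane_represents_one[OF two A herm, of y x 0 1])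
        (use that 1 yx in \<open>auto simp: a_def pure_def\<close>)
  next
    case 2
    then have "a dvd 1" by (metis dvdI eq_iff_diff_eq_0)
    then obtain d where d: "a = [:d:]" using 2 by (metis is_unit_iff_degree degree_eq_zeroE)
    obtain b where b: "b ^ 2 = d" using nth_root_exists[of 2 d] by auto
    have "b \<noteq> 0" using b d 2 by auto
    have "hform A (\<lambda>i. [:1 / b:] * x i) (\<lambda>i. [:1 / b:] * x i) = [:1 / b:] * ([:1 / b:] * a)"
      by (simp only: hform_scale_left hform_scale_right pstar_const a_def)
    also have "\<dots> = 1" using b \<open>b \<noteq> 0\<close> by (auto simp: d one_pCons power2_eq_square field_simps)
    finally show ?thesis by (rule that)
  next
    case 3
    then obtain k w where w: "pure w" "1 - a * c = ([:0, 1:] ^ k * w) * pstar ([:0, 1:] ^ k * w)"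
      using even_poly_norm[OF two, of "1 - a * c"] ac by auto
    \<comment> \<open>Changing the sign of \<open>w\<close> excludes the value 1 at 0 without
      changing the norm.\<close>
    have "\<exists>w. pure w \<and> 1 - a * c = ([:0, 1:] ^ k * w) * pstar ([:0, 1:] ^ k * w)
      \<and> (poly a 0 = 0 \<longrightarrow> poly ([:0, 1:] ^ k * w) 0 \<noteq> 1)"
    proof (cases "poly ([:0, 1:] ^ k * w) 0 = 1")
      case True
      then show ?thesis using w pure_smult[of "- 1" w] two by (intro exI[of _ "- w"]) auto
    next
      case False
      then show ?thesis using w by blast
    qed
    then obtain w where w: "pure w" "1 - a * c = ([:0, 1:] ^ k * w) * pstar ([:0, 1:] ^ k * w)"
      and w0: "poly a 0 = 0 \<Longrightarrow> poly ([:0, 1:] ^ k * w) 0 \<noteq> 1" by blast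
    obtain z \<alpha> \<beta> where z: "hform A z z = 0" "hform A (\<lambda>i. \<alpha> * x i + \<beta> * y i) z = [:0, 1:] ^ k * w"
      "poly ([:0, 1:] ^ k * w) 0 = 0 \<Longrightarrow> poly (hform A x x) 0 * poly \<alpha> 0 + 1 * poly \<beta> 0 = 1"
    proof (rule isotropic_vector[OF two A herm _ xy, of "[:0, 1:] ^ k * w"])
      show "hform A x x \<noteq> 0" using 3 by (simp add: a_def)
      show "[:0, 1:] ^ k * w * pstar ([:0, 1:] ^ k * w) = 1 - Polynomial.smult 1 (hform A x x * hform A y y)"
        using w(2) by (simp add: a_def c_def)
      show "[:0, 1:] ^ k * w \<noteq> 0" using w(1) by (simp add: pure_def)
    qed (use w0 in \<open>auto simp: a_def\<close>)
    show ?thesis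
    proof (rule hermitian_plane_represents_one[OF two A herm z(2) w(1) z(1)])
      \<comment> \<open>The Gram determinant vanishes at 0, so there a times the form is the square
        of a \<alpha> + \<beta>, which the choice of \<alpha> and \<beta> makes 1. Hence the value
        at 0 is nonzero.\<close>
      assume "k > 0"
      then have t0: "poly ([:0, 1:] ^ k * w) 0 = 0" by simp
      have "poly (1 - a * c) 0 = 0" unfolding w(2) poly_mult[of "[:0, 1:] ^ k * w"] t0 by simp
      then have ac1: "poly a 0 * poly c 0 = 1" by simp
      have ab: "poly a 0 * poly \<alpha> 0 + poly \<beta> 0 = 1" using z(3)[OF t0] by (simp add: a_def)
      define d where "d = poly (hform A (\<lambda>i. \<alpha> * x i + \<beta> * y i) (\<lambda>i. \<alpha> * x i + \<beta> * y i)) 0"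
      have "d = poly a 0 * poly \<alpha> 0 ^ 2 + 2 * poly \<alpha> 0 * poly \<beta> 0 + poly c 0 * poly \<beta> 0 ^ 2"
        unfolding d_def using xy yx by (simp add: power2_eq_square algebra_simps flip: a_def c_def)
      then have "poly a 0 * d = (poly a 0 * poly \<alpha> 0) ^ 2 + 2 * (poly a 0 * poly \<alpha> 0) * poly \<beta> 0
        + (poly a 0 * poly c 0) * poly \<beta> 0 ^ 2" by (simp add: power2_eq_square algebra_simps)
      also have "\<dots> = (poly a 0 * poly \<alpha> 0 + poly \<beta> 0) ^ 2" unfolding ac1
        by (simp add: power2_eq_square algebra_simps)
      finally show "d \<noteq> 0" unfolding ab by auto
    qed (rule that)
  qed
qed

section \<open>Splitting off a block\<close>

text \<open>Subtracting a multiple of one argument realizes the remainder of a division by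
  \<open>g\<close> as a value of the form, and minimality of the degree makes it zero.\<close>

lemma degree_minimal_hform_dvd:
  fixes A :: "'a::field poly mat"
  assumes min: "\<And>x y. hform A x y \<noteq> 0 \<Longrightarrow> degree g \<le> degree (hform A x y)"
    and g: "g \<noteq> 0" "hform A x y = g"
  shows "g dvd hform A x y'" "g dvd hform A x' y"
proof -
  have small: "r mod g = 0" if "r mod g \<noteq> 0 \<Longrightarrow> degree g \<le> degree (r mod g)" for r
    using that degree_mod_less[of g r] g(1) by (metis leD)
  show "g dvd hform A x y'"
  proof -
    define q where "q = hform A x y' div g"
    have "hform A x (\<lambda>i. y' i - q * y i) = hform A x y' mod g"
      using g(2) by (simp add: q_def minus_div_mult_eq_mod)
    then show ?thesis using small[of "hform A x y'"] min by (metis mod_eq_0_iff_dvd)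
  qed
  show "g dvd hform A x' y"
  proof -
    define q where "q = hform A x' y div g"
    have "hform A (\<lambda>i. x' i - pstar q * x i) y = hform A x' y mod g"
      using g(2) by (simp add: q_def minus_div_mult_eq_mod)
    then show ?thesis using small[of "hform A x' y"] min by (metis mod_eq_0_iff_dvd)
  qed
qed

text \<open>A value \<open>g\<close> of least degree divides all values that share an argument with
  it. For arbitrary \<open>x'\<close>, \<open>y'\<close>, multiples of \<open>x\<close> and
  \<open>y\<close> are subtracted so that the cross terms vanish.\<close>

lemma hform_generator:
  fixes A :: "'a::field poly mat"
  assumes "hform A x0 y0 \<noteq> 0"
  obtains x y where "hform A x y \<noteq> 0" "\<And>x' y'. hform A x y dvd hform A x' y'"
proof -
  obtain x y where nz: "hform A x y \<noteq> 0" and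
    min0: "\<And>x' y'. hform A x' y' \<noteq> 0 \<Longrightarrow> degree (hform A x y) \<le> degree (hform A x' y')"
    using ex_has_least_nat[of "\<lambda>v. hform A (fst v) (snd v) \<noteq> 0" "(x0, y0)" "\<lambda>v. degree (hform A (fst v) (snd v))"]
      assms by auto
  define g where "g = hform A x y"
  note min = degree_minimal_hform_dvd[where A = A and g = g, OF min0[folded g_def]]
  have g: "g \<noteq> 0" "hform A x y = g" using nz by (simp_all add: g_def)
  have "g dvd hform A x' y'" for x' y'
  proof -
    obtain \<alpha> where \<alpha>: "hform A x y' = g * \<alpha>" using min(1)[OF _ g] by (metis dvdE)
    obtain \<beta> where \<beta>: "hform A x' y = g * \<beta>" using min(2)[OF _ g] by (metis dvdE)
    \<comment> \<open>The vector added to \<open>x\<close> pairs with \<open>y\<close> to 0, so the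
      sum still attains \<open>g\<close> against \<open>y\<close> and is as good as
      \<open>x\<close>.\<close>
    have "hform A (\<lambda>i. x i + (x' i - pstar \<beta> * x i)) y = g" using \<beta> g by simp
    from min(1)[OF _ g(1) this] have "g dvd hform A (\<lambda>i. x i + (x' i - pstar \<beta> * x i)) (\<lambda>i. y' i - \<alpha> * y i)" by blast
    then have "g dvd hform A x' y' - \<alpha> * (g * \<beta>)" using \<alpha> \<beta> g by simp
    moreover have "g dvd \<alpha> * (g * \<beta>)" by simp
    ultimately show ?thesis by (metis diff_add_cancel dvd_add)
  qed
  then show ?thesis using that[of x y] g by simp
qed

lemma hform_functional:
  assumes A: "A \<in> carrier_mat n n"
  shows "hform A x y = (\<Sum>j<n. hform A x (\<lambda>k. if k = j then 1 else 0) * y j)"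
proof -
  have "hform A x (\<lambda>k. if k = j then 1 else 0) = (\<Sum>i<n. pstar (x i) * A $$ (i, j))" if "j < n" for j
  proof -
    have "hform A x (\<lambda>k. if k = j then 1 else 0) = (\<Sum>i<n. \<Sum>l<n. if l = j then pstar (x i) * A $$ (i, l) else 0)"
      unfolding hform_def using A by (intro sum.cong) auto
    then show ?thesis using that by simp
  qed
  then have "(\<Sum>j<n. hform A x (\<lambda>k. if k = j then 1 else 0) * y j) = (\<Sum>j<n. \<Sum>i<n. pstar (x i) * A $$ (i, j) * y j)"
    by (intro sum.cong) (auto simp: sum_distrib_right)
  also have "\<dots> = hform A x y" unfolding hform_def using A by (subst sum.swap) auto
  finally show ?thesis ..
qed

text \<open>The coefficients \<open>r\<close> of the quotient functional are the certificates that
  column completion asks for.\<close>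

lemma hform_functional_div:
  fixes A :: "'a::field poly mat"
  assumes A: "A \<in> carrier_mat n n" and d: "\<And>y. d dvd hform A x y"
  obtains r where "\<And>y. hform A x y = d * (\<Sum>j<n. r j * y j)"
proof -
  have "\<exists>r. \<forall>j. hform A x (\<lambda>k. if k = j then 1 else 0) = d * r j"
    by (intro choice allI) (use d in \<open>blast elim: dvdE\<close>)
  then obtain r where r: "\<And>j. hform A x (\<lambda>k. if k = j then 1 else 0) = d * r j" by blast
  have "hform A x y = d * (\<Sum>j<n. r j * y j)" for y
    unfolding hform_functional[OF A, of x y] r by (simp add: sum_distrib_left mult.assoc)
  then show ?thesis by (rule that)
qed

text \<open>The functional h(v, -) is 1 at \<open>v\<close>, so \<open>v\<close> belongs to a basis,
  and y - h(v, y) v projects onto its complement.\<close>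

lemma split_unit_vector:
  fixes A :: "'a::field poly mat"
  assumes A: "A \<in> carrier_mat (Suc m) (Suc m)" and herm: "mat_star A = map_mat (Polynomial.smult 1) A"
    and v: "hform A v v = 1"
  shows "\<exists>D \<in> carrier_mat m m. mat_star D = map_mat (Polynomial.smult 1) D \<and>
    congruent_mat (Suc m) A (dsum (mat 1 1 (\<lambda>_. 1)) D)"
proof -
  obtain r where r: "\<And>y. hform A v y = 1 * (\<Sum>j<Suc m. r j * y j)"
    using hform_functional_div[OF A, of 1 v, OF one_dvd] by blast
  then have "(\<Sum>j<Suc m. r j * v j) = 1" using v by simp
  then obtain S where S: "S \<in> carrier_mat (Suc m) (Suc m)" "invertible_mat S" and Sv: "\<forall>i<Suc m. S $$ (i, 0) = v i"
    using unimodular_column by blast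
  have Sl: "hform A (\<lambda>k. S $$ (k, 0)) y = hform A v y" for y using Sv by (intro hform_cong[OF A]) auto
  have Sr: "hform A y (\<lambda>k. S $$ (k, 0)) = hform A y v" for y using Sv by (intro hform_cong[OF A]) auto
  have "\<exists>c. \<forall>i<1. hform A (\<lambda>r. S $$ (r, i)) (\<lambda>r. y r + (\<Sum>l<1. S $$ (r, l) * c l)) = 0" for y
    using v by (intro exI[of _ "\<lambda>_. - hform A v y"]) (simp add: Sl Sr mult.commute)
  from split_off[where k = 1 and m = m, OF _ herm _ _ S(2) this]
  obtain D where D: "D \<in> carrier_mat m m" "mat_star D = map_mat (Polynomial.smult 1) D"
    "congruent_mat (1 + m) A (dsum (mat 1 1 (\<lambda>(i, j). hform A (\<lambda>r. S $$ (r, i)) (\<lambda>r. S $$ (r, j)))) D)"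
    using A S by auto
  have "mat 1 1 (\<lambda>(i, j). hform A (\<lambda>r. S $$ (r, i)) (\<lambda>r. S $$ (r, j))) = mat 1 1 (\<lambda>_. 1)"
    using v by (intro eq_matI) (auto simp: Sl Sr)
  then show ?thesis using D by auto
qed

abbreviation plane :: "'a::zero \<Rightarrow> 'a \<Rightarrow> 'a mat" where
  "plane a b \<equiv> mat22 0 a b 0"

lemma mutually_coprime_dvd:
  fixes q :: "'a::field poly"
  assumes "pure q" "q dvd c" "pstar q dvd c"
  shows "q * pstar q dvd c"
proof -
  obtain x y where xy: "q * x + pstar q * y = 1" using assms(1) unfolding pure_def by (meson coprime_bezout)
  have "c = (q * c) * x + (pstar q * c) * y" using arg_cong[OF xy, of "\<lambda>u. c * u"] by (simp add: algebra_simps)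
  moreover have "q * pstar q dvd q * c" "q * pstar q dvd pstar q * c"
    using assms by (simp_all add: mult.commute mult_dvd_mono)
  ultimately show ?thesis by (metis dvd_add dvd_mult2)
qed

text \<open>The gcd of the two values is again a value h(z, -), and it is pure as a divisor of a
  pure polynomial. By minimality it is associated to h(z, X).\<close>

lemma minimal_pure_dvd:
  fixes A :: "'a::field poly mat"
  assumes min: "\<And>v. pure (hform A z v) \<Longrightarrow> degree (hform A z X) \<le> degree (hform A z v)"
    and q: "pure (hform A z X)"
  shows "hform A z X dvd hform A z y"
proof -
  obtain a b where ab: "hform A z X * a + hform A z y * b dvd hform A z X"
    "hform A z X * a + hform A z y * b dvd hform A z y" by (rule bezout_poly)
  define g where "g = hform A z X * a + hform A z y * b"
  have g: "g = hform A z (\<lambda>i. a * X i + b * y i)" by (simp add: g_def mult.commute)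
  have "degree (hform A z X) \<le> degree g"
    using min pure_dvd[OF q ab(1)] unfolding g_def[symmetric] g by blast
  moreover have "hform A z X \<noteq> 0" using q by (simp add: pure_def)
  moreover obtain k where k: "hform A z X = g * k" using ab(1) unfolding g_def[symmetric] by (elim dvdE)
  ultimately have "degree k = 0" by (auto simp: degree_mult_eq)
  then have "is_unit k" using k \<open>hform A z X \<noteq> 0\<close> by (auto simp: is_unit_iff_degree)
  moreover have "g dvd hform A z y" using ab(2) by (simp add: g_def)
  ultimately show ?thesis using k by (simp add: mult_unit_dvd_iff)
qed

lemma split_skew_plane:
  fixes A :: "'a::alg_closed_field poly mat"
  assumes two: "(2::'a) \<noteq> 0" and A: "A \<in> carrier_mat n n"
    and herm: "mat_star A = map_mat (Polynomial.smult (- 1)) A" and xy: "hform A x y = 1"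
  obtains m q D where "n = Suc (Suc m)" "pure q" "lead_coeff (q * pstar q) = 1" "D \<in> carrier_mat m m"
    "mat_star D = map_mat (Polynomial.smult (- 1)) D" "congruent_mat n A (dsum (plane q (- pstar q)) D)"
    "\<forall>i<m. \<forall>j<m. q * pstar q dvd D $$ (i, j)"
proof -
  have "- hform A y x = pstar (hform A x y)" for x y using hform_hermitian[OF A herm, of y x] by simp
  then have sym: "hform A y x = - pstar (hform A x y)" for x y by (metis add.inverse_inverse)
  have sym': "pstar (hform A x x) = - hform A x x" for x using sym[of x x] by (metis add.inverse_inverse)
  define P where "P z v \<longleftrightarrow> hform A z z = 0 \<and> pure (hform A z v)" for z v
  obtain z1 v1 where zv1: "P z1 v1" using skew_isotropic_pure[OF two A herm xy] unfolding P_def by metis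
  obtain z0 v0 where zv0: "P z0 v0" and min0: "\<And>z v. P z v \<Longrightarrow> degree (hform A z0 v0) \<le> degree (hform A z v)"
    using ex_has_least_nat[of "\<lambda>p. P (fst p) (snd p)" "(z1, v1)" "\<lambda>p. degree (hform A (fst p) (snd p))"] zv1 by auto
  have nz0: "hform A z0 v0 \<noteq> 0" using zv0 by (simp add: P_def pure_def)
  define l where "l = lead_coeff (hform A z0 v0 * pstar (hform A z0 v0))"
  have "l \<noteq> 0" using nz0 by (simp only: l_def leading_coeff_0_iff) simp
  \<comment> \<open>Rescaling \<open>z0\<close> by \<open>b\<close> multiplies q q* by b^2. This
    makes it monic, as the invariant factor f q q* requires.\<close>
  obtain b where b: "b ^ 2 = 1 / l" using nth_root_exists[of 2 "1 / l"] by auto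
  have "b \<noteq> 0" using b \<open>l \<noteq> 0\<close> by auto
  define z where "z i = [:b:] * z0 i" for i
  have zl: "hform A z v = [:b:] * hform A z0 v" for v unfolding z_def by (simp only: hform_scale_left pstar_const)
  have zr: "hform A v z = [:b:] * hform A v z0" for v unfolding z_def by (simp only: hform_scale_right)
  have zz: "hform A z z = 0" using zv0 by (simp add: zl zr P_def)
  define q where "q = hform A z v0"
  have q: "pure q" using zv0 \<open>b \<noteq> 0\<close> by (simp add: q_def zl P_def)
  have qb: "q * pstar q = Polynomial.smult (b ^ 2) (hform A z0 v0 * pstar (hform A z0 v0))"
    by (simp add: q_def zl power2_eq_square)
  have lc: "lead_coeff (q * pstar q) = 1"
    unfolding qb lead_coeff_smult using \<open>l \<noteq> 0\<close> by (simp add: l_def[symmetric] b)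
  have min: "degree q \<le> degree (hform A z v)" if "P z v" for z v
    using min0[OF that] \<open>b \<noteq> 0\<close> by (simp add: q_def zl)
  \<comment> \<open>Since \<open>z\<close> is isotropic, adding \<open>u * z\<close> to
    \<open>v0\<close> preserves its pairing with \<open>z\<close> and changes h(v0, v0) by a skew
    trace, which is chosen to cancel it.\<close>
  obtain u where u: "pstar q * u + Polynomial.smult (- 1) (pstar (pstar q) * pstar u) = hform A v0 v0"
  proof (rule pure_trace_eq[OF two, of "pstar q" "hform A v0 v0" "- 1"])
    show "pstar (hform A v0 v0) = Polynomial.smult (- 1) (hform A v0 v0)" using sym'[of v0] by simp
  qed (use q in auto)
  define X where "X i = v0 i + u * z i" for i
  have zX: "hform A z X = q" unfolding X_def by (simp add: zz q_def)
  have Xz: "hform A X z = - pstar q" using sym[of X z] zX by simp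
  have "hform A X X = hform A v0 v0 + u * hform A v0 z + (pstar u * q + pstar u * (u * hform A z z))"
    unfolding X_def by (simp add: q_def algebra_simps)
  also have "\<dots> = 0" unfolding u[symmetric] using sym[of v0 z] by (simp add: zz algebra_simps flip: q_def)
  finally have XX: "hform A X X = 0" .
  have nzq: "q \<noteq> 0" using q by (simp add: pure_def)
  have qz: "q dvd hform A z y" for y
    using minimal_pure_dvd[of A z X y] min[unfolded P_def, of z] zz q zX by auto
  have qX: "- pstar q dvd hform A X y" for y
    using minimal_pure_dvd[of A X z y] min[unfolded P_def, of X] XX q Xz pure_smult[of "- 1" "pstar q"] by auto
  have orth: "q * pstar q dvd hform A v y"
    if v: "hform A z v = 0" "hform A X v = 0" and y: "hform A z y = 0" "hform A X y = 0" for v y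
  proof -
    have half: "q dvd hform A v y"
      if v: "hform A z v = 0" "hform A X v = 0" and y: "hform A z y = 0" "hform A X y = 0" for v y
    proof -
      obtain \<beta> where \<beta>: "q * \<beta> + Polynomial.smult (- 1) (pstar q * pstar \<beta>) = - hform A v v"
      proof (rule pure_trace_eq[OF two q, of "- hform A v v" "- 1"])
        show "pstar (- hform A v v) = Polynomial.smult (- 1) (- hform A v v)" using sym'[of v] by simp
      qed auto
      \<comment> \<open>By the choice of \<beta> this vector is isotropic, and it still pairs with
        \<open>X\<close> to \<open>q\<close>, so minimality applies to it as well. For
        \<open>y\<close> in the complement, h(z', y) is h(v, y).\<close>
      define z' where "z' i = z i + \<beta> * X i + v i" for i
      have v': "hform A v z = 0" "hform A v X = 0" using v sym[of v z] sym[of v X] by auto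
      have "hform A z' z' = (q * \<beta> + Polynomial.smult (- 1) (pstar q * pstar \<beta>)) + hform A v v"
        unfolding z'_def by (simp add: zz zX Xz XX v v' algebra_simps)
      then have "hform A z' z' = 0" unfolding \<beta> by simp
      moreover have z'X: "hform A z' X = q" unfolding z'_def by (simp add: zX XX v')
      ultimately have "q dvd hform A z' y"
        using minimal_pure_dvd[of A z' X y] min[unfolded P_def, of z'] q by auto
      then show ?thesis unfolding z'_def by (simp add: y)
    qed
    \<comment> \<open>Exchanging \<open>v\<close> and \<open>y\<close> and conjugating gives the
      second divisor.\<close>
    have "pstar q dvd pstar (hform A y v)" using half[OF y v] by (rule pstar_dvd_pstar)
    then have "pstar q dvd hform A v y" using sym[of v y] by simp
    then show ?thesis using half[OF v y] q by (intro mutually_coprime_dvd)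
  qed
  \<comment> \<open>The functionals \<open>r\<close> and \<open>s\<close> are dual to
    \<open>z\<close> and \<open>X\<close>. They certify that \<open>z\<close>, \<open>X\<close>
    extend to a basis, and y - r(y) z - s(y) X is the projection onto the complement.\<close>
  obtain r where r: "\<And>y. hform A X y = - pstar q * (\<Sum>j<n. r j * y j)"
    using hform_functional_div[OF A qX] by metis
  obtain s where s: "\<And>y. hform A z y = q * (\<Sum>j<n. s j * y j)"
    using hform_functional_div[OF A qz] by metis
  have rz: "(\<Sum>j<n. r j * z j) = 1" using r[of z] nzq by (simp add: Xz)
  have sz: "(\<Sum>j<n. s j * z j) = 0" using s[of z] nzq by (simp add: zz)
  have sX: "(\<Sum>j<n. s j * X j) = 1" using s[of X] nzq by (simp add: zX)
  have "n \<noteq> 0" using rz by (intro notI) simp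
  moreover have "n \<noteq> 1" using rz sz sX by (intro notI) auto
  ultimately obtain m where n: "n = Suc (Suc m)" by (metis One_nat_def not0_implies_Suc)
  obtain S where S: "S \<in> carrier_mat n n" "invertible_mat S" and Sv: "\<forall>i<n. S $$ (i, 0) = z i" "\<forall>i<n. S $$ (i, 1) = X i"
    using unimodular_two_columns[OF rz sz sX] by blast
  have Sl: "hform A (\<lambda>k. S $$ (k, 0)) y = hform A z y" "hform A (\<lambda>k. S $$ (k, Suc 0)) y = hform A X y"
    and Sr: "hform A y (\<lambda>k. S $$ (k, 0)) = hform A y z" "hform A y (\<lambda>k. S $$ (k, Suc 0)) = hform A y X" for y
    using Sv by (auto intro!: hform_cong[OF A])
  have less2: "i < 2 \<longleftrightarrow> i = 0 \<or> i = Suc 0" for i :: nat by auto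
  have proj: "\<exists>c. \<forall>i<2. hform A (\<lambda>r. S $$ (r, i)) (\<lambda>r. y r + (\<Sum>l<2. S $$ (r, l) * c l)) = 0" for y
  proof -
    define c where "c = (\<lambda>l::nat. if l = 0 then - (\<Sum>j<n. r j * y j) else - (\<Sum>j<n. s j * y j))"
    have "(\<lambda>k. y k + (\<Sum>l<2. S $$ (k, l) * c l)) = (\<lambda>k. y k + c 0 * S $$ (k, 0) + c 1 * S $$ (k, Suc 0))"
      by (auto simp: numeral_2_eq_2 algebra_simps)
    then show ?thesis
      by (intro exI[of _ c]) (simp add: less2 Sl Sr zz XX zX Xz r[of y] s[of y], simp add: c_def algebra_simps)
  qed
  from split_off[where k = 2 and m = m, OF _ herm _ _ S(2) proj]
  obtain D where D: "D \<in> carrier_mat m m" "mat_star D = map_mat (Polynomial.smult (- 1)) D"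
    "congruent_mat (2 + m) A (dsum (mat 2 2 (\<lambda>(i, j). hform A (\<lambda>r. S $$ (r, i)) (\<lambda>r. S $$ (r, j)))) D)"
    and Dy: "\<And>i j. i < m \<Longrightarrow> j < m \<Longrightarrow> \<exists>y y'. D $$ (i, j) = hform A y y' \<and>
        (\<forall>l<2. hform A (\<lambda>r. S $$ (r, l)) y = 0 \<and> hform A (\<lambda>r. S $$ (r, l)) y' = 0)"
    using A S by (auto simp: n)
  have "mat 2 2 (\<lambda>(i, j). hform A (\<lambda>r. S $$ (r, i)) (\<lambda>r. S $$ (r, j))) = plane q (- pstar q)"
    by (rule eq_matI) (auto simp: mat22_def less2 Sl Sr zz zX Xz XX)
  then have "congruent_mat n A (dsum (plane q (- pstar q)) D)" using D by (simp add: n)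
  moreover have "q * pstar q dvd D $$ (i, j)" if "i < m" "j < m" for i j
    using Dy[OF that] orth by (auto simp: less2 Sl)
  ultimately show ?thesis using that[OF n q lc D(1,2)] by blast
qed

section \<open>The canonical form and the invariant factors\<close>

lemma pair_start_0: "pair_start e n fs 0 \<longleftrightarrow> oddt e n fs 0"
  by (simp add: pair_start_def)

text \<open>The part of a run before an index grows by one inside the run and is empty after an
  index of another type. The parity condition thus becomes an alternation, which suits
  recursion.\<close>

lemma pair_start_Suc:
  "pair_start e n fs (Suc k) \<longleftrightarrow> oddt e n fs (Suc k) \<and> \<not> pair_start e n fs k"
proof -
  define J where "J k = {j. j < k \<and> (\<forall>l\<in>{j..<k}. oddt e n fs l)}" for k
  have "J (Suc k) = (if oddt e n fs k then insert k (J k) else {})"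
    by (auto simp: J_def less_Suc_eq atLeastLessThanSuc)
  moreover have "finite (J k)" "k \<notin> J k" by (auto simp: J_def)
  ultimately have "card (J (Suc k)) = (if oddt e n fs k then Suc (card (J k)) else 0)" by simp
  then show ?thesis unfolding pair_start_def J_def[symmetric] by auto
qed

lemma oddt_shift: "oddt e (m + n) fs (m + k) \<longleftrightarrow> oddt e n (\<lambda>i. fs (m + i)) k"
  by (simp add: oddt_def)

text \<open>Only values below \<open>n\<close> enter, and these are all that uniqueness of the
  invariant factors controls.\<close>

lemma canon_cong:
  assumes "\<And>i. i < n \<Longrightarrow> fs i = fs' i"
  shows "canon e n fs p = canon e n fs' p" "typed_seq e n fs = typed_seq e n fs'"
    "valid_pairing e n fs p = valid_pairing e n fs' p"
proof -
  have o: "oddt e n fs = oddt e n fs'" using assms by (auto simp: oddt_def fun_eq_iff)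
  then have ps: "pair_start e n fs = pair_start e n fs'" by (simp add: pair_start_def fun_eq_iff)
  have "pair_start e n fs' k \<Longrightarrow> k < n" for k by (simp add: pair_start_def oddt_def)
  then show "valid_pairing e n fs p = valid_pairing e n fs' p"
    unfolding valid_pairing_def ps o using assms by (metis Suc_lessD)
  show "typed_seq e n fs = typed_seq e n fs'" unfolding typed_seq_def o using assms by simp
  show "canon e n fs p = canon e n fs' p"
    unfolding canon_def ps using assms by (intro eq_matI) auto
qed

text \<open>The alternation looks back by one index only. If no pair straddles the cut after
  \<open>m\<close>, the pairing of the tail starts afresh.\<close>

lemma pair_start_shift:
  assumes "\<not> pair_start e (Suc m + n) fs m"
  shows "pair_start e (Suc m + n) fs (Suc m + k) \<longleftrightarrow> pair_start e n (\<lambda>i. fs (Suc m + i)) k"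
proof (induction k)
  case 0
  have "pair_start e (Suc m + n) fs (Suc m) \<longleftrightarrow> oddt e (Suc m + n) fs (Suc m + 0)"
    unfolding pair_start_Suc using assms by simp
  then show ?case unfolding oddt_shift pair_start_0 by simp
next
  case (Suc k)
  have "pair_start e (Suc m + n) fs (Suc m + Suc k) \<longleftrightarrow>
    oddt e (Suc m + n) fs (Suc m + Suc k) \<and> \<not> pair_start e (Suc m + n) fs (Suc m + k)"
    unfolding add_Suc_right pair_start_Suc by (rule refl)
  then show ?case unfolding Suc oddt_shift pair_start_Suc[of e n] .
qed

context
  fixes e :: "'a::field"
  assumes two: "(2::'a) \<noteq> 0" and e: "e = 1 \<or> e = - 1"
begin

lemma not_even_and_odd:
  assumes "oddt e n fs k"
  shows "pstar (fs k) \<noteq> Polynomial.smult e (fs k)"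
proof
  assume "pstar (fs k) = Polynomial.smult e (fs k)"
  then have "Polynomial.smult (e + e) (fs k) = 0"
    using assms unfolding oddt_def smult_add_left by simp
  then show False using assms two e by (auto simp: oddt_def simp flip: mult_2)
qed

lemma typed_seq_Suc:
  "typed_seq e (Suc n) fs \<longleftrightarrow>
    (pstar (fs 0) = Polynomial.smult e (fs 0) \<or> oddt e (Suc n) fs 0) \<and> typed_seq e n (\<lambda>i. fs (Suc i))"
  unfolding typed_seq_def using oddt_shift[of e 1 n fs] by (auto simp: less_Suc_eq_0_disj)

lemma pair_start_single:
  assumes "pstar (fs 0) = Polynomial.smult e (fs 0)"
  shows "\<not> pair_start e (Suc n) fs 0" "pair_start e (Suc n) fs (Suc k) \<longleftrightarrow> pair_start e n (\<lambda>i. fs (Suc i)) k"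
proof -
  show "\<not> pair_start e (Suc n) fs 0" using not_even_and_odd assms unfolding pair_start_0 by blast
  then show "pair_start e (Suc n) fs (Suc k) \<longleftrightarrow> pair_start e n (\<lambda>i. fs (Suc i)) k"
    using pair_start_shift[of e 0 n fs k] by simp
qed

lemma pair_start_pair:
  assumes "oddt e (Suc (Suc n)) fs 0"
  shows "pair_start e (Suc (Suc n)) fs 0" "\<not> pair_start e (Suc (Suc n)) fs (Suc 0)"
    "pair_start e (Suc (Suc n)) fs (Suc (Suc k)) \<longleftrightarrow> pair_start e n (\<lambda>i. fs (Suc (Suc i))) k"
proof -
  show "pair_start e (Suc (Suc n)) fs 0" using assms unfolding pair_start_0 .
  then show "\<not> pair_start e (Suc (Suc n)) fs (Suc 0)" unfolding pair_start_Suc by simp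
  then show "pair_start e (Suc (Suc n)) fs (Suc (Suc k)) \<longleftrightarrow> pair_start e n (\<lambda>i. fs (Suc (Suc i))) k"
    using pair_start_shift[of e 1 n fs k] by simp
qed

lemma valid_pairing_single:
  assumes "pstar (fs 0) = Polynomial.smult e (fs 0)"
  shows "valid_pairing e (Suc n) fs p \<longleftrightarrow> valid_pairing e n (\<lambda>i. fs (Suc i)) (\<lambda>i. p (Suc i))"
proof -
  have "(\<forall>k. P k) \<longleftrightarrow> P 0 \<and> (\<forall>k. P (Suc k))" for P :: "nat \<Rightarrow> bool" by (metis nat.exhaust)
  note this[of "\<lambda>k. pair_start e (Suc n) fs k \<longrightarrow> Q k" for Q]
  then show ?thesis unfolding valid_pairing_def
    using pair_start_single[of fs, OF assms] oddt_shift[of e 1 n fs] by simp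
qed

lemma valid_pairing_pair:
  assumes "oddt e (Suc (Suc n)) fs 0"
  shows "valid_pairing e (Suc (Suc n)) fs p \<longleftrightarrow>
    oddt e (Suc (Suc n)) fs (Suc 0) \<and> pure (p 0) \<and> fs (Suc 0) = fs 0 * p 0 * pstar (p 0) \<and>
    valid_pairing e n (\<lambda>i. fs (Suc (Suc i))) (\<lambda>i. p (Suc (Suc i)))"
proof -
  have "(\<forall>k. P k) \<longleftrightarrow> P 0 \<and> P (Suc 0) \<and> (\<forall>k. P (Suc (Suc k)))" for P :: "nat \<Rightarrow> bool" by (metis nat.exhaust)
  note this[of "\<lambda>k. pair_start e (Suc (Suc n)) fs k \<longrightarrow> Q k" for Q]
  then show ?thesis unfolding valid_pairing_def
    using pair_start_pair[OF assms] oddt_shift[of e 2 n fs] by (simp add: numeral_2_eq_2)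
qed

lemma canon_single:
  assumes "pstar (fs 0) = Polynomial.smult e (fs 0)"
  shows "canon e (Suc n) fs p = dsum (mat 1 1 (\<lambda>_. fs 0)) (canon e n (\<lambda>i. fs (Suc i)) (\<lambda>i. p (Suc i)))"
proof (rule eq_matI)
  fix i j assume "i < dim_row (dsum (mat 1 1 (\<lambda>_. fs 0)) (canon e n (\<lambda>i. fs (Suc i)) (\<lambda>i. p (Suc i))))"
    "j < dim_col (dsum (mat 1 1 (\<lambda>_. fs 0)) (canon e n (\<lambda>i. fs (Suc i)) (\<lambda>i. p (Suc i))))"
  then have "i < Suc n" "j < Suc n" by (simp_all add: dsum_def canon_def)
  then show "canon e (Suc n) fs p $$ (i, j)
    = dsum (mat 1 1 (\<lambda>_. fs 0)) (canon e n (\<lambda>i. fs (Suc i)) (\<lambda>i. p (Suc i))) $$ (i, j)"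
    using pair_start_single[of fs, OF assms] assms
    by (cases i; cases j) (auto simp: canon_def dsum_def)
qed (simp_all add: canon_def dsum_def)

lemma canon_pair:
  assumes "oddt e (Suc (Suc n)) fs 0" "oddt e (Suc (Suc n)) fs (Suc 0)"
  shows "canon e (Suc (Suc n)) fs p = dsum (plane (fs 0 * p 0) (Polynomial.smult e (pstar (fs 0 * p 0))))
    (canon e n (\<lambda>i. fs (Suc (Suc i))) (\<lambda>i. p (Suc (Suc i))))" (is "_ = ?R")
proof (rule eq_matI)
  fix i j assume "i < dim_row ?R" "j < dim_col ?R"
  then have ij: "i < Suc (Suc n)" "j < Suc (Suc n)" by (simp_all add: dsum_def canon_def mat22_def)
  have split: "k = 0 \<or> k = Suc 0 \<or> (\<exists>k'. k = Suc (Suc k') \<and> k' < n)" if "k < Suc (Suc n)" for k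
    using that by (cases k; cases "k - 1") auto
  show "canon e (Suc (Suc n)) fs p $$ (i, j) = ?R $$ (i, j)"
    using split[OF ij(1)] split[OF ij(2)] pair_start_pair[OF assms(1)]
      not_even_and_odd[OF assms(1)] not_even_and_odd[OF assms(2)]
    by (auto simp: canon_def dsum_def mat22_def)
qed (simp_all add: canon_def dsum_def mat22_def)

end

text \<open>Induction over the diagonal blocks from the top left. A first entry that is not of type
  (i) starts a pair, and \<open>valid_pairing\<close> supplies its partner.\<close>

lemma canon_induct [consumes 4, case_names Nil single pair]:
  fixes e :: "'a::field"
  assumes two: "(2::'a) \<noteq> 0" and e: "e = 1 \<or> e = - 1"
    and tv: "typed_seq e n fs" "valid_pairing e n fs p"
    and "\<And>fs p. P 0 fs p"
    and "\<And>n fs p. pstar (fs 0) = Polynomial.smult e (fs 0) \<Longrightarrow>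
      P n (\<lambda>i. fs (Suc i)) (\<lambda>i. p (Suc i)) \<Longrightarrow> P (Suc n) fs p"
    and "\<And>n fs p. oddt e (Suc (Suc n)) fs 0 \<Longrightarrow> oddt e (Suc (Suc n)) fs (Suc 0) \<Longrightarrow> pure (p 0) \<Longrightarrow>
      fs (Suc 0) = fs 0 * p 0 * pstar (p 0) \<Longrightarrow>
      P n (\<lambda>i. fs (Suc (Suc i))) (\<lambda>i. p (Suc (Suc i))) \<Longrightarrow> P (Suc (Suc n)) fs p"
  shows "P n fs p"
  using tv
proof (induction n arbitrary: fs p rule: less_induct)
  case (less n)
  show ?case
  proof (cases n)
    case 0
    then show ?thesis using assms(5) by simp
  next
    case (Suc m)
    show ?thesis
    proof (cases "pstar (fs 0) = Polynomial.smult e (fs 0)")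
      case True
      then show ?thesis
        using assms(6)[of fs m p] less.IH[of m] less.prems valid_pairing_single[OF two e, of fs m p] typed_seq_Suc[OF two e, of m fs]
        unfolding Suc by simp
    next
      case False
      then have odd: "oddt e n fs 0" using less.prems typed_seq_Suc[OF two e, of m fs] Suc by simp
      then have "Suc 0 < n" using less.prems(2) unfolding valid_pairing_def pair_start_0[symmetric] by blast
      then obtain k where k: "n = Suc (Suc k)" using Suc by (cases m) auto
      note v = less.prems(2)[unfolded k valid_pairing_pair[OF two e odd[unfolded k]]]
      have "typed_seq e k (\<lambda>i. fs (Suc (Suc i)))"
        using less.prems(1) typed_seq_Suc[OF two e, of "Suc k" fs] typed_seq_Suc[OF two e, of k "\<lambda>i. fs (Suc i)"] by (simp add: k)
      then show ?thesis
        using assms(7)[of k fs p] less.IH[of k] v odd unfolding k by simp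
    qed
  qed
qed

section \<open>Equivalence of matrices and uniqueness of the Smith normal form\<close>

definition equivalent_mat :: "nat \<Rightarrow> 'a::comm_ring_1 mat \<Rightarrow> 'a mat \<Rightarrow> bool" where
  "equivalent_mat n A B \<longleftrightarrow> (\<exists>P \<in> carrier_mat n n. \<exists>Q \<in> carrier_mat n n.
     invertible_mat P \<and> invertible_mat Q \<and> P * A * Q = B)"

lemma equivalent_refl: "A \<in> carrier_mat n n \<Longrightarrow> equivalent_mat n A A"
  unfolding equivalent_mat_def by (rule bexI[of _ "1\<^sub>m n"], rule bexI[of _ "1\<^sub>m n"]) auto

lemma equivalent_trans:
  assumes A: "A \<in> carrier_mat n n" and "equivalent_mat n A B" "equivalent_mat n B C"
  shows "equivalent_mat n A C"
proof -
  obtain P Q R S where P: "P \<in> carrier_mat n n" "invertible_mat P" and Q: "Q \<in> carrier_mat n n" "invertible_mat Q"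
    and R: "R \<in> carrier_mat n n" "invertible_mat R" and S: "S \<in> carrier_mat n n" "invertible_mat S"
    and B: "P * A * Q = B" and C: "R * B * S = C"
    using assms(2,3) unfolding equivalent_mat_def by blast
  have "(R * P) * A * (Q * S) = C" unfolding C[symmetric] B[symmetric] using A P(1) Q(1) R(1) S(1)
    by (simp add: assoc_mult_mat[of _ n n _ n _ n] mult_carrier_mat[of _ n n _ n])
  then show ?thesis unfolding equivalent_mat_def
    using invertible_mat_mult[OF R(1) P(1) R(2) P(2)] invertible_mat_mult[OF Q(1) S(1) Q(2) S(2)]
      mult_carrier_mat[OF R(1) P(1)] mult_carrier_mat[OF Q(1) S(1)] by blast
qed

lemma equivalent_sym:
  assumes A: "A \<in> carrier_mat n n" and "equivalent_mat n A B"
  shows "equivalent_mat n B A"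
proof -
  obtain P Q where P: "P \<in> carrier_mat n n" "invertible_mat P" and Q: "Q \<in> carrier_mat n n" "invertible_mat Q"
    and B: "P * A * Q = B" using assms(2) unfolding equivalent_mat_def by blast
  obtain P' where P': "P' \<in> carrier_mat n n" "P * P' = 1\<^sub>m n" "P' * P = 1\<^sub>m n" by (metis P invertible_mat_obtain)
  obtain Q' where Q': "Q' \<in> carrier_mat n n" "Q * Q' = 1\<^sub>m n" "Q' * Q = 1\<^sub>m n" by (metis Q invertible_mat_obtain)
  have "P' * B * Q' = (P' * P) * A * (Q * Q')" unfolding B[symmetric] using A P(1) Q(1) P'(1) Q'(1)
    by (simp add: assoc_mult_mat[of _ n n _ n _ n] mult_carrier_mat[of _ n n _ n] del: index_mult_mat)
  then have "P' * B * Q' = A" using A P' Q' by simp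
  then show ?thesis unfolding equivalent_mat_def
    using P' Q' invertible_matI[OF P'(1) P(1)] invertible_matI[OF Q'(1) Q(1)] by blast
qed

lemma congruent_imp_equivalent: "congruent_mat n A B \<Longrightarrow> equivalent_mat n A B"
  unfolding congruent_mat_def equivalent_mat_def using invertible_mat_star mat_star_carrier by blast

lemma equivalent_dsum:
  fixes A :: "'a::idom mat"
  assumes A: "A \<in> carrier_mat k k" and D: "D \<in> carrier_mat m m"
    and "equivalent_mat k A A'" "equivalent_mat m D D'"
  shows "equivalent_mat (k + m) (dsum A D) (dsum A' D')"
proof -
  obtain P Q R S where P: "P \<in> carrier_mat k k" "invertible_mat P" and Q: "Q \<in> carrier_mat k k" "invertible_mat Q"
    and R: "R \<in> carrier_mat m m" "invertible_mat R" and S: "S \<in> carrier_mat m m" "invertible_mat S"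
    and A': "P * A * Q = A'" and D': "R * D * S = D'"
    using assms(3,4) unfolding equivalent_mat_def by blast
  have "dsum P R * dsum A D * dsum Q S = dsum A' D'"
    unfolding A'[symmetric] D'[symmetric] using P(1) Q(1) R(1) S(1) A D
    by (simp add: dsum_mult[of _ k _ _ m] mult_carrier_mat[of _ k k _ k] mult_carrier_mat[of _ m m _ m])
  then show ?thesis unfolding equivalent_mat_def
    using invertible_dsum[OF P(1) R(1) P(2) R(2)] invertible_dsum[OF Q(1) S(1) Q(2) S(2)]
      dsum_carrier[OF P(1) R(1)] dsum_carrier[OF Q(1) S(1)] by blast
qed

text \<open>Every permutation of the indices meets the block of rows \<open>\<ge> i\<close> and columns \<open>\<le> i\<close>,
  whose entries in \<open>P\<close> become divisible by \<open>d' i\<close> after multiplication by \<open>d i\<close>.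
  Hence \<open>d' i\<close> divides \<open>d i * det P\<close>.\<close>
lemma smith_chain_dvd:
  fixes d d' :: "nat \<Rightarrow> 'a::field poly"
  assumes eq: "equivalent_mat n (diag_of n d) (diag_of n d')"
    and d: "smith_chain n d" and d': "smith_chain n d'" and i: "i < n"
  shows "d' i dvd d i"
proof -
  have mono: "c a dvd c b" if "smith_chain n c" "a \<le> b" "b < n" for c :: "nat \<Rightarrow> 'a poly" and a b
    using that(2,3) by (induction b rule: dec_induct) (use that(1) in \<open>auto simp: smith_chain_def intro: dvd_trans\<close>)
  obtain P Q where P: "P \<in> carrier_mat n n" "invertible_mat P" and Q: "Q \<in> carrier_mat n n" "invertible_mat Q"
    and eq': "P * diag_of n d * Q = diag_of n d'" using eq unfolding equivalent_mat_def by blast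
  obtain Q' where Q': "Q' \<in> carrier_mat n n" "Q * Q' = 1\<^sub>m n" by (metis Q invertible_mat_obtain)
  have c: "diag_of n c \<in> carrier_mat n n" for c :: "nat \<Rightarrow> 'a poly" by (simp add: diag_of_def)
  have "P * diag_of n d = P * diag_of n d * (Q * Q')" using P c Q' by (simp add: mult_carrier_mat[of _ n n _ n] right_mult_one_mat[of _ n n])
  also have "\<dots> = diag_of n d' * Q'" unfolding eq'[symmetric] using P(1) c Q(1) Q'(1)
    by (simp add: assoc_mult_mat[of _ n n _ n _ n] mult_carrier_mat[of _ n n _ n])
  finally have PQ: "P * diag_of n d = diag_of n d' * Q'" .
  have delta: "x * (if b then y else 0) = (if b then x * y else 0)"
    "(if b then y else 0) * x = (if b then y * x else 0)" for x y :: "'a poly" and b by auto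
  have entry: "P $$ (a, b) * d b = d' a * Q' $$ (a, b)" if "a < n" "b < n" for a b
  proof -
    have "(P * diag_of n d) $$ (a, b) = (\<Sum>k<n. if k = b then P $$ (a, k) * d k else 0)"
      using that by (subst index_mult_sum[OF P(1) c]) (auto simp: diag_of_def delta)
    moreover have "(diag_of n d' * Q') $$ (a, b) = (\<Sum>k<n. if k = a then d' k * Q' $$ (k, b) else 0)"
      using that by (subst index_mult_sum[OF c Q'(1)]) (auto simp: diag_of_def delta)
    ultimately show ?thesis using PQ that by simp
  qed
  have block: "d' i dvd d i * P $$ (a, b)" if "i \<le> a" "a < n" "b \<le> i" for a b
  proof -
    have "d' i dvd P $$ (a, b) * d b" using entry[of a b] mono[OF d' that(1,2)] that by auto
    moreover have "d b dvd d i" using mono[OF d that(3) i] .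
    ultimately show ?thesis by (metis dvd_trans mult.commute mult_dvd_mono dvd_refl)
  qed
  have "d' i dvd d i * det P"
    unfolding det_def'[OF P(1)] sum_distrib_left
  proof (rule dvd_sum)
    fix \<sigma> assume "\<sigma> \<in> {\<sigma>. \<sigma> permutes {0..<n}}"
    then have \<sigma>: "\<sigma> permutes {0..<n}" by simp
    \<comment> \<open>Pigeonhole: there are n - i rows from \<open>i\<close> on, but only n - i - 1
      columns beyond \<open>i\<close>.\<close>
    have "\<exists>a. i \<le> a \<and> a < n \<and> \<sigma> a \<le> i"
    proof (rule ccontr)
      assume "\<nexists>a. i \<le> a \<and> a < n \<and> \<sigma> a \<le> i"
      then have "\<sigma> ` {i..<n} \<subseteq> {Suc i..<n}" using permutes_in_image[OF \<sigma>] by fastforce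
      then have "card {i..<n} \<le> card {Suc i..<n}"
        using permutes_inj_on[OF \<sigma>] by (metis card_image card_mono finite_atLeastLessThan)
      then show False using i by simp
    qed
    then obtain a where a: "i \<le> a" "a < n" "\<sigma> a \<le> i" by blast
    have "P $$ (a, \<sigma> a) dvd (\<Prod>a = 0..<n. P $$ (a, \<sigma> a))" using a by (intro dvd_prodI) auto
    then have "d i * P $$ (a, \<sigma> a) dvd d i * (signof \<sigma> * (\<Prod>a = 0..<n. P $$ (a, \<sigma> a)))" by simp
    then show "d' i dvd d i * (signof \<sigma> * (\<Prod>a = 0..<n. P $$ (a, \<sigma> a)))"
      using block[OF a] by (rule dvd_trans[rotated])
  qed
  moreover have "det P dvd 1" using P invertible_mat_iff_det by blast
  ultimately show ?thesis by (simp add: dvd_mult_unit_iff)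
qed

lemma monic_dvd_antisym:
  fixes a b :: "'a::field poly"
  assumes "a dvd b" "b dvd a" "a = 0 \<or> lead_coeff a = 1" "b = 0 \<or> lead_coeff b = 1"
  shows "b = a"
proof (cases "a = 0")
  case True
  then show ?thesis using assms(1) by simp
next
  case False
  obtain k where k: "b = a * k" using assms(1) by (elim dvdE)
  have "b \<noteq> 0" using False assms(2) by auto
  moreover have "degree b \<le> degree a" using assms(2) False by (rule dvd_imp_degree_le)
  ultimately have "degree k = 0" using k False by (auto simp: degree_mult_eq)
  then obtain c where c: "k = [:c:]" by (rule degree_eq_zeroE)
  have "lead_coeff b = lead_coeff a * c" by (simp add: k c)
  then show ?thesis using assms(3,4) False \<open>b \<noteq> 0\<close> k c by simp
qed

lemma smith_chain_unique:
  fixes d d' :: "nat \<Rightarrow> 'a::field poly"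
  assumes eq: "equivalent_mat n (diag_of n d) (diag_of n d')"
    and d: "smith_chain n d" and d': "smith_chain n d'" and i: "i < n"
  shows "d' i = d i"
proof -
  have "diag_of n d \<in> carrier_mat n n" by (simp add: diag_of_def)
  from equivalent_sym[OF this eq] have "d i dvd d' i" using smith_chain_dvd d d' i by blast
  moreover have "d' i dvd d i" using smith_chain_dvd[OF eq d d' i] .
  moreover have "d i = 0 \<or> lead_coeff (d i) = 1" "d' i = 0 \<or> lead_coeff (d' i) = 1"
    using d d' i by (auto simp: smith_chain_def)
  ultimately show ?thesis by (rule monic_dvd_antisym)
qed

text \<open>The entries have gcd g, as \<open>p\<close> is pure, and the determinant is g^2 p p*,
  which forces the Smith form. Bezout coefficients of \<open>p\<close> and \<open>pstar p\<close>
  give transformations of determinant one.\<close>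

lemma equivalent_plane:
  fixes g p :: "'a::field poly"
  assumes "pure p"
  shows "equivalent_mat 2 (plane (g * p) (- (g * pstar p))) (mat22 g 0 0 (g * p * pstar p))"
proof -
  obtain a b where ab: "p * a + pstar p * b = 1" using assms unfolding pure_def by (meson coprime_bezout)
  have "mat22 a b (- pstar p) p * plane (g * p) (- (g * pstar p)) * mat22 (- 1) (- (p * a)) 1 (- (pstar p * b))
    = mat22 (g * (p * a + pstar p * b)) 0 0 (g * p * pstar p * (p * a + pstar p * b))"
    unfolding mat22_mult by (intro arg_cong4[of _ _ _ _ _ _ _ _ mat22]) (simp_all add: algebra_simps)
  then have "mat22 a b (- pstar p) p * plane (g * p) (- (g * pstar p)) * mat22 (- 1) (- (p * a)) 1 (- (pstar p * b))
    = mat22 g 0 0 (g * p * pstar p)" unfolding ab by simp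
  moreover have "invertible_mat (mat22 a b (- pstar p) p)" "invertible_mat (mat22 (- 1) (- (p * a)) 1 (- (pstar p * b)))"
    using ab by (auto intro!: invertible_mat22[where k = 1] simp: algebra_simps)
  ultimately show ?thesis unfolding equivalent_mat_def by (meson mat22_carrier)
qed

text \<open>With p = k m and p' = k m' for the gcd k, equality of the norms forces m' to be
  \<open>pstar m\<close> up to sign. The column with entries m and \<open>pstar k\<close> is
  isotropic; up to that sign it becomes the first vector of the new basis.\<close>

lemma congruent_plane:
  fixes p p' :: "'a::field poly"
  assumes two: "(2::'a) \<noteq> 0" and p: "pure p" and p': "pure p'" and eq: "p * pstar p = p' * pstar p'"
  shows "congruent_mat 2 (plane p (- pstar p)) (plane p' (- pstar p'))"
proof -
  obtain k m m' \<delta> \<gamma> where k: "p = k * m" "p' = k * m'" and "m * \<delta> - m' * \<gamma> = 1"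
    by (rule gcd_decomposition)
  have nz: "p \<noteq> 0" using p by (simp add: pure_def)
  have "(k * pstar k) * (m * pstar m) = (k * pstar k) * (m' * pstar m')"
    using eq unfolding k by (simp add: ac_simps)
  then have mm: "m * pstar m = m' * pstar m'" using nz k by simp
  have "pstar m' = pstar m' * (m * \<delta> - m' * \<gamma>)" using \<open>m * \<delta> - m' * \<gamma> = 1\<close> by simp
  also have "\<dots> = m * (pstar m' * \<delta> - pstar m * \<gamma>)"
    using mm by (simp add: algebra_simps)
  finally obtain c where c: "pstar m' = m * c" by blast
  then have c': "m' = pstar m * pstar c" by (metis pstar_mult pstar_pstar)
  have "(m * pstar m) * (c * pstar c) = (m * pstar m) * 1" using mm unfolding c' by (simp add: ac_simps)
  \<comment> \<open>A polynomial of norm 1 is constant and hence its own conjugate; \<open>c\<close>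
    is the sign.\<close>
  then have cc: "c * pstar c = 1" using nz k by (metis mult_eq_0_iff mult_left_cancel pstar_eq_0_iff)
  have "degree c = 0"
    using arg_cong[OF cc, of degree] cc by (subst (asm) degree_mult_eq) auto
  then obtain c0 where c0: "c = [:c0:]" by (rule degree_eq_zeroE)
  then have sc: "pstar c = c" by simp
  define Y where "Y = k * pstar m"
  have p'Y: "p' = c * Y" unfolding Y_def k c' sc by (simp add: ac_simps)
  have "Y dvd p'" by (simp add: p'Y)
  then have Y: "pure Y" using p' pure_dvd by blast
  have "coprime m (pstar k)" using p unfolding pure_def k
    by (auto intro: coprime_divisors[of m "k * m" "pstar k" "pstar (k * m)"])
  then obtain x y where xy: "m * x + pstar k * y = 1" by (rule coprime_bezout)
  \<comment> \<open>The value of the form at the column (-y, x), which completes (m,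
    \<open>pstar k\<close>) to a matrix of determinant one. Subtracting \<open>u\<close> times the
    latter column cancels this value.\<close>
  define d where "d = - pstar y * p * x + pstar x * pstar p * y"
  have sd: "pstar (- d) = Polynomial.smult (- 1) (- d)" by (simp add: d_def)
  obtain u where u: "pstar Y * u + Polynomial.smult (- 1) (pstar (pstar Y) * pstar u) = - d"
    by (rule pure_trace_eq[OF two _ sd, of "pstar Y"]) (use Y in simp)
  define S where "S = mat22 (c * m) (- y - u * m) (c * pstar k) (x - u * pstar k)"
  have "invertible_mat S" unfolding S_def
  proof (rule invertible_mat22)
    have "c * m * (x - u * pstar k) - (- y - u * m) * (c * pstar k) = c * (m * x + pstar k * y)"
      by (simp add: algebra_simps)
    then show "(c * m * (x - u * pstar k) - (- y - u * m) * (c * pstar k)) * c = 1"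
      unfolding xy using cc sc by simp
  qed
  moreover have "mat_star S * plane p (- pstar p) * S = plane p' (- pstar p')"
  proof -
    have xy': "pstar m * pstar x + k * pstar y = 1" using arg_cong[OF xy, of pstar] by simp
    have "mat_star S * plane p (- pstar p) * S = mat22 0 (c * Y * (m * x + pstar k * y))
        (- (c * pstar Y * (pstar m * pstar x + k * pstar y)))
        (d + pstar Y * u * (pstar m * pstar x + k * pstar y) - Y * pstar u * (m * x + pstar k * y))"
      unfolding S_def mat_star_mat22 mat22_mult
      by (intro arg_cong4[of _ _ _ _ _ _ _ _ mat22]) (simp_all add: sc Y_def d_def k algebra_simps)
    moreover have "d + pstar Y * u - Y * pstar u = 0" using u by (simp add: algebra_simps)
    ultimately show ?thesis unfolding xy xy' p'Y by (simp add: sc)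
  qed
  ultimately show ?thesis unfolding congruent_mat_def by (metis S_def mat22_carrier)
qed

lemma smult_plane: "f \<cdot>\<^sub>m plane a b = plane (f * a) (f * b)" for f :: "'a::comm_ring_1"
  by (rule eq_matI) (auto simp: mat22_def)

context
  fixes e :: "'a::field"
  assumes two: "(2::'a) \<noteq> 0" and e: "e = 1 \<or> e = - 1"
begin

text \<open>For either sign \<open>e\<close>, the odd symmetry of \<open>fs k\<close> turns the
  prescribed lower entry into that of a skew plane scaled by \<open>fs k\<close>.\<close>

lemma oddt_block:
  assumes "oddt e n fs k"
  shows "Polynomial.smult e (pstar (fs k * q)) = - (fs k * pstar q)"
  using assms e by (auto simp: oddt_def)

lemma canon_equivalent_diag:
  assumes "typed_seq e n fs" "valid_pairing e n fs p"
  shows "equivalent_mat n (canon e n fs p) (diag_of n fs)"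
  using two e assms
proof (induction n fs p rule: canon_induct)
  case (Nil fs p)
  have "canon e 0 fs p = diag_of 0 fs" by (rule eq_matI) (auto simp: canon_def diag_of_def)
  then show ?case using equivalent_refl[of "diag_of 0 fs" 0] by (simp add: diag_of_def)
next
  case (single n fs p)
  have "diag_of (Suc n) fs = dsum (mat 1 1 (\<lambda>_. fs 0)) (diag_of n (\<lambda>i. fs (Suc i)))"
    by (rule eq_matI) (auto simp: diag_of_def dsum_def)
  then show ?case
    using equivalent_dsum[of "mat 1 1 (\<lambda>_. fs 0)" 1 "canon e n (\<lambda>i. fs (Suc i)) (\<lambda>i. p (Suc i))" n]
      single equivalent_refl[of "mat 1 1 (\<lambda>_. fs 0)" 1] canon_single[where fs = fs, OF two e single(1)]
    by (simp add: canon_def)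
next
  case (pair n fs p)
  have "diag_of (Suc (Suc n)) fs = dsum (mat22 (fs 0) 0 0 (fs 0 * p 0 * pstar (p 0))) (diag_of n (\<lambda>i. fs (Suc (Suc i))))"
    unfolding pair(4)[symmetric] by (rule eq_matI) (auto simp: diag_of_def dsum_def mat22_def less_Suc_eq_0_disj)
  moreover have "canon e (Suc (Suc n)) fs p = dsum (plane (fs 0 * p 0) (- (fs 0 * pstar (p 0))))
      (canon e n (\<lambda>i. fs (Suc (Suc i))) (\<lambda>i. p (Suc (Suc i))))"
    unfolding canon_pair[OF two e pair(1,2)] oddt_block[OF pair(1)] ..
  ultimately show ?case
    using equivalent_dsum[OF mat22_carrier, of "canon e n (\<lambda>i. fs (Suc (Suc i))) (\<lambda>i. p (Suc (Suc i)))" n]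
      equivalent_plane[OF pair(3)] pair(5) by (simp add: canon_def)
qed

text \<open>The invariant factors do not determine \<open>p k\<close>, but cancelling the nonzero
  \<open>fs k\<close> shows that they determine its norm; the blocks are then compared one by
  one.\<close>

lemma canon_change_pairing:
  assumes "typed_seq e n fs" "valid_pairing e n fs p" "valid_pairing e n fs p'"
  shows "congruent_mat n (canon e n fs p) (canon e n fs p')"
proof -
  have "valid_pairing e n fs p' \<longrightarrow> congruent_mat n (canon e n fs p) (canon e n fs p')" for p'
    using two e assms(1,2)
  proof (induction n fs p arbitrary: p' rule: canon_induct)
    case (Nil fs p)
    have "canon e 0 fs p = canon e 0 fs p'" by (rule eq_matI) (auto simp: canon_def)
    then show ?case using congruent_refl[of "canon e 0 fs p" 0] by (simp add: canon_def)
  next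
    case (single n fs p)
    then show ?case
      using congruent_dsum[of "mat 1 1 (\<lambda>_. fs 0)" 1 "canon e n (\<lambda>i. fs (Suc i)) (\<lambda>i. p (Suc i))" n]
        congruent_refl[of "mat 1 1 (\<lambda>_. fs 0)" 1] canon_single[where fs = fs, OF two e single(1)]
        valid_pairing_single[where fs = fs, OF two e single(1)]
      by (simp add: canon_def)
  next
    case (pair n fs p)
    show ?case
    proof
      assume "valid_pairing e (Suc (Suc n)) fs p'"
      note v' = this[unfolded valid_pairing_pair[OF two e pair(1)]]
      have "fs 0 \<noteq> 0" using pair(1) by (simp add: oddt_def)
      moreover have "fs 0 * (p 0 * pstar (p 0)) = fs 0 * (p' 0 * pstar (p' 0))" using v' pair(4) by (simp add: mult.assoc)
      ultimately have "p 0 * pstar (p 0) = p' 0 * pstar (p' 0)" by simp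
      then have "congruent_mat 2 (plane (p 0) (- pstar (p 0))) (plane (p' 0) (- pstar (p' 0)))"
        using congruent_plane[OF two pair(3)] v' by blast
      from congruent_smult[OF mat22_carrier this, of "fs 0"]
      have "congruent_mat 2 (plane (fs 0 * p 0) (- (fs 0 * pstar (p 0)))) (plane (fs 0 * p' 0) (- (fs 0 * pstar (p' 0))))"
        by (simp add: smult_plane)
      moreover have "canon e (Suc (Suc n)) fs q = dsum (plane (fs 0 * q 0) (- (fs 0 * pstar (q 0))))
          (canon e n (\<lambda>i. fs (Suc (Suc i))) (\<lambda>i. q (Suc (Suc i))))" for q
        unfolding canon_pair[OF two e pair(1,2)] oddt_block[OF pair(1)] ..
      ultimately show "congruent_mat (Suc (Suc n)) (canon e (Suc (Suc n)) fs p) (canon e (Suc (Suc n)) fs p')"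
        using congruent_dsum[OF mat22_carrier, of "canon e n (\<lambda>i. fs (Suc (Suc i))) (\<lambda>i. p (Suc (Suc i)))" n]
          pair(5)[of "\<lambda>i. p' (Suc (Suc i))"] v' by (simp add: canon_def)
    qed
  qed
  then show ?thesis using assms(3) by blast
qed

end

section \<open>Existence of the canonical form\<close>

lemma smith_chain_case_nat:
  assumes "smith_chain n fs" "\<And>i. i < n \<Longrightarrow> f dvd fs i" "lead_coeff f = 1"
  shows "smith_chain (Suc n) (case_nat f fs)"
  using assms unfolding smith_chain_def by (auto split: nat.split)

lemma hermitian_smult:
  assumes "mat_star D = map_mat (Polynomial.smult e) D" "pstar f = Polynomial.smult d f"
  shows "mat_star (f \<cdot>\<^sub>m D) = map_mat (Polynomial.smult (d * e)) (f \<cdot>\<^sub>m D)"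
proof (rule eq_matI)
  fix i j assume "i < dim_row (map_mat (Polynomial.smult (d * e)) (f \<cdot>\<^sub>m D))" "j < dim_col (map_mat (Polynomial.smult (d * e)) (f \<cdot>\<^sub>m D))"
  moreover have "dim_row D = dim_col D" using arg_cong[OF assms(1), of dim_row] by simp
  ultimately have ij: "i < dim_row D" "j < dim_col D" "i < dim_col D" "j < dim_row D" by auto
  have "pstar (D $$ (j, i)) = Polynomial.smult e (D $$ (i, j))"
    using arg_cong[OF assms(1), of "\<lambda>M. M $$ (i, j)"] ij by simp
  then show "mat_star (f \<cdot>\<^sub>m D) $$ (i, j) = map_mat (Polynomial.smult (d * e)) (f \<cdot>\<^sub>m D) $$ (i, j)"
    using ij assms(2) by (simp add: mult.commute)
qed (use arg_cong[OF assms(1), of dim_row] arg_cong[OF assms(1), of dim_col] in auto)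

text \<open>The monic generator \<open>f\<close> of all values is the gcd of the entries. Its
  conjugate is again a value up to sign, so \<open>f\<close> divides \<open>pstar f\<close>, and
  equality of degrees leaves a constant \<open>d\<close> with square 1. Dividing by \<open>f\<close>
  multiplies the sign of the symmetry by \<open>d\<close>.\<close>

lemma hermitian_content:
  fixes A :: "'a::field poly mat"
  assumes A: "A \<in> carrier_mat n n" and herm: "mat_star A = map_mat (Polynomial.smult e) A"
    and e: "e = 1 \<or> e = - 1" and nz: "i < n" "j < n" "A $$ (i, j) \<noteq> 0"
  obtains f B x y d where "A = f \<cdot>\<^sub>m B" "B \<in> carrier_mat n n" "lead_coeff f = 1" "hform B x y = 1"
    "d = 1 \<or> d = - 1" "pstar f = Polynomial.smult d f" "mat_star B = map_mat (Polynomial.smult (d * e)) B"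
    "\<forall>g. (\<forall>i<n. \<forall>j<n. g dvd A $$ (i, j)) \<longrightarrow> g dvd f"
proof -
  have "hform A (\<lambda>k. if k = i then 1 else 0) (\<lambda>k. if k = j then 1 else 0) \<noteq> 0"
    using hform_unit[OF A nz(1,2)] nz(3) by simp
  then obtain x y0 where xy0: "hform A x y0 \<noteq> 0" and dvd0: "\<And>x' y'. hform A x y0 dvd hform A x' y'"
    using hform_generator by metis
  define l where "l = lead_coeff (hform A x y0)"
  have "l \<noteq> 0" using xy0 by (simp add: l_def)
  define y where "y i = [:1 / l:] * y0 i" for i
  define f where "f = hform A x y"
  have f: "f = Polynomial.smult (1 / l) (hform A x y0)" unfolding f_def y_def
    by (simp only: hform_scale_right) simp
  have lc: "lead_coeff f = 1" using \<open>l \<noteq> 0\<close> unfolding f by (simp add: l_def)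
  then have fnz: "f \<noteq> 0" by auto
  have fdvd: "f dvd hform A x' y'" for x' y'
    using dvd0 \<open>l \<noteq> 0\<close> unfolding f by (simp add: smult_dvd_iff)
  have fA: "f dvd A $$ (i, j)" if "i < n" "j < n" for i j
    using fdvd hform_unit[OF A that] by metis
  define B where "B = mat n n (\<lambda>(i, j). A $$ (i, j) div f)"
  have B: "B \<in> carrier_mat n n" by (simp add: B_def)
  have AB: "A = f \<cdot>\<^sub>m B" using A fA by (intro eq_matI) (auto simp: B_def)
  have "f * hform B x y = f * 1" using f_def unfolding AB hform_smult by simp
  then have one: "hform B x y = 1" using fnz mult_left_cancel by blast
  have "pstar f = Polynomial.smult e (hform A y x)" unfolding f_def hform_hermitian[OF A herm] ..
  then have "f dvd pstar f" using fdvd by (simp add: dvd_smult)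
  then obtain k where k: "pstar f = f * k" by (elim dvdE)
  have "degree (pstar f) = degree f + degree k" using fnz k by (metis degree_mult_eq mult_zero_right pstar_eq_0_iff)
  then have "degree k = 0" by simp
  then obtain d where d: "k = [:d:]" by (rule degree_eq_zeroE)
  have fd: "pstar f = Polynomial.smult d f" by (simp add: k d)
  have "f = Polynomial.smult d (Polynomial.smult d f)" using fd by (metis pstar_pstar pstar_smult)
  then have "lead_coeff f = d * d * lead_coeff f" by (metis lead_coeff_smult mult.assoc)
  then have "d ^ 2 = 1" using lc by (simp add: power2_eq_square)
  then have d1: "d = 1 \<or> d = - 1" by (simp add: power2_eq_1_iff)
  have B_herm: "mat_star B = map_mat (Polynomial.smult (d * e)) B"
  proof (rule eq_matI)
    fix i j assume "i < dim_row (map_mat (Polynomial.smult (d * e)) B)" "j < dim_col (map_mat (Polynomial.smult (d * e)) B)"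
    then have ij: "i < n" "j < n" using B by auto
    have "pstar (A $$ (j, i)) = Polynomial.smult e (A $$ (i, j))"
      using arg_cong[OF herm, of "\<lambda>M. M $$ (i, j)"] ij A by simp
    then have "Polynomial.smult d f * pstar (B $$ (j, i)) = Polynomial.smult e (f * B $$ (i, j))"
      using ij B unfolding AB by (simp add: fd)
    then have "f * pstar (B $$ (j, i)) = f * Polynomial.smult (d * e) (B $$ (i, j))"
      using d1 by (auto simp: minus_equation_iff[of "f * _"])
    then have "pstar (B $$ (j, i)) = Polynomial.smult (d * e) (B $$ (i, j))" using fnz mult_left_cancel by blast
    then show "mat_star B $$ (i, j) = map_mat (Polynomial.smult (d * e)) B $$ (i, j)" using ij B by simp
  qed (use B in auto)
  have "g dvd f" if "\<forall>i<n. \<forall>j<n. g dvd A $$ (i, j)" for g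
    unfolding f_def hform_def using that A by (auto intro!: dvd_sum)
  then show ?thesis using that[OF AB B lc one d1 fd B_herm] by blast
qed

text \<open>The last conjunct strengthens the induction: applied to the remaining matrix it shows
  that the factors just split off divide all later ones, so that the divisibility chain
  extends.\<close>

theorem congruent_canon:
  fixes A :: "'a::alg_closed_field poly mat"
  assumes two: "(2::'a) \<noteq> 0" and e: "e = 1 \<or> e = - 1"
    and "A \<in> carrier_mat n n" "mat_star A = map_mat (Polynomial.smult e) A"
  shows "\<exists>fs p. smith_chain n fs \<and> typed_seq e n fs \<and> valid_pairing e n fs p \<and>
    congruent_mat n A (canon e n fs p) \<and>
    (\<forall>g. (\<forall>i<n. \<forall>j<n. g dvd A $$ (i, j)) \<longrightarrow> (\<forall>i<n. g dvd fs i))"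
  using assms(3,4)
proof (induction n arbitrary: A rule: less_induct)
  case (less n)
  note A = less.prems(1) and herm = less.prems(2)
  show ?case
  proof (cases "\<exists>i<n. \<exists>j<n. A $$ (i, j) \<noteq> 0")
    case False
    have not_pair: "\<not> pair_start e n (\<lambda>_. 0) k" for k by (simp add: pair_start_def oddt_def)
    then have "A = canon e n (\<lambda>_. 0) (\<lambda>_. 0)"
      using False A by (intro eq_matI) (auto simp: canon_def)
    then have "congruent_mat n A (canon e n (\<lambda>_. 0) (\<lambda>_. 0))" using congruent_refl[OF A] by simp
    then show ?thesis using not_pair
      by (intro exI[of _ "\<lambda>_. 0"]) (auto simp: smith_chain_def typed_seq_def valid_pairing_def)
  next
    case True
    then obtain i j where ij: "i < n" "j < n" "A $$ (i, j) \<noteq> 0" by blast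
    obtain f B x y d where AB: "A = f \<cdot>\<^sub>m B" and B: "B \<in> carrier_mat n n" and lc: "lead_coeff f = 1"
      and xy: "hform B x y = 1" and d: "d = 1 \<or> d = - 1" and fd: "pstar f = Polynomial.smult d f"
      and B_herm: "mat_star B = map_mat (Polynomial.smult (d * e)) B"
      and content: "\<forall>g. (\<forall>i<n. \<forall>j<n. g dvd A $$ (i, j)) \<longrightarrow> g dvd f"
      by (rule hermitian_content[OF A herm e ij])
    have fnz: "f \<noteq> 0" using lc by auto
    show ?thesis
    proof (cases "d = e")
      case True
      then have "d * e = 1" using e by auto
      then have B_herm: "mat_star B = map_mat (Polynomial.smult 1) B" using B_herm by simp
      obtain m where n: "n = Suc m" using ij by (cases n) auto
      obtain v where "hform B v v = 1" by (rule hermitian_represents_one[OF two B B_herm xy])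
      then obtain D where D: "D \<in> carrier_mat m m" "mat_star D = map_mat (Polynomial.smult 1) D"
        "congruent_mat (Suc m) B (dsum (mat 1 1 (\<lambda>_. 1)) D)"
        using split_unit_vector[of B m v] B B_herm unfolding n by blast
      have fD: "f \<cdot>\<^sub>m D \<in> carrier_mat m m" using D by simp
      have "mat_star (f \<cdot>\<^sub>m D) = map_mat (Polynomial.smult e) (f \<cdot>\<^sub>m D)"
        using hermitian_smult[OF D(2) fd] True by simp
      then obtain fs p where IH: "smith_chain m fs" "typed_seq e m fs" "valid_pairing e m fs p"
        "congruent_mat m (f \<cdot>\<^sub>m D) (canon e m fs p)" and
        dvd: "\<And>g. \<forall>i<m. \<forall>j<m. g dvd (f \<cdot>\<^sub>m D) $$ (i, j) \<Longrightarrow> \<forall>i<m. g dvd fs i"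
        using less.IH[of m "f \<cdot>\<^sub>m D"] fD n by blast
      have f_dvd: "f dvd fs i" if "i < m" for i using dvd[of f] D that by auto
      define gs where "gs = case_nat f fs"
      \<comment> \<open>Index 0 starts no pair, so 0 is a default value there.\<close>
      define r where "r = case_nat 0 p"
      have gs: "gs 0 = f" "\<And>i. gs (Suc i) = fs i" "\<And>i. r (Suc i) = p i" by (simp_all add: gs_def r_def)
      have g0: "pstar (gs 0) = Polynomial.smult e (gs 0)" using fd True gs by simp
      have "smith_chain n gs" unfolding n gs_def using IH(1) f_dvd lc by (intro smith_chain_case_nat) auto
      moreover have "typed_seq e n gs" unfolding n typed_seq_Suc[OF two e] using IH(2) g0 gs by simp
      moreover have "valid_pairing e n gs r"
        unfolding n valid_pairing_single[where fs = gs, OF two e g0] using IH(3) gs by simp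
      moreover have "congruent_mat n A (canon e n gs r)"
      proof (rule congruent_trans[OF A])
        have "congruent_mat n A (f \<cdot>\<^sub>m dsum (mat 1 1 (\<lambda>_. 1)) D)"
          unfolding AB using congruent_smult[OF B] D(3) n by blast
        moreover have "f \<cdot>\<^sub>m mat 1 1 (\<lambda>_. 1) = mat 1 1 (\<lambda>_. f)" by (rule eq_matI) auto
        ultimately show "congruent_mat n A (dsum (mat 1 1 (\<lambda>_. f)) (f \<cdot>\<^sub>m D))" by (simp add: smult_dsum)
        show "congruent_mat n (dsum (mat 1 1 (\<lambda>_. f)) (f \<cdot>\<^sub>m D)) (canon e n gs r)"
          unfolding n canon_single[where fs = gs, OF two e g0]
          using congruent_dsum[OF _ fD congruent_refl IH(4), of "mat 1 1 (\<lambda>_. f)" 1] gs by simp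
      qed
      moreover have "\<forall>i<n. g dvd gs i" if "\<forall>i<n. \<forall>j<n. g dvd A $$ (i, j)" for g
        proof -
        have "g dvd f" using content that by blast
        then show ?thesis using f_dvd unfolding n gs_def by (auto split: nat.split intro: dvd_trans)
      qed
      ultimately show ?thesis by blast
    next
      case False
      then have de: "d * e = - 1" "d = - e" using e d by auto
      then have B_herm: "mat_star B = map_mat (Polynomial.smult (- 1)) B" using B_herm by simp
      obtain m q D where n: "n = Suc (Suc m)" and q: "pure q" "lead_coeff (q * pstar q) = 1"
        and D: "D \<in> carrier_mat m m" "mat_star D = map_mat (Polynomial.smult (- 1)) D"
        "congruent_mat n B (dsum (plane q (- pstar q)) D)"
        and qD: "\<forall>i<m. \<forall>j<m. q * pstar q dvd D $$ (i, j)"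
        by (rule split_skew_plane[OF two B B_herm xy])
      have fD: "f \<cdot>\<^sub>m D \<in> carrier_mat m m" using D by simp
      have "mat_star (f \<cdot>\<^sub>m D) = map_mat (Polynomial.smult e) (f \<cdot>\<^sub>m D)"
        using hermitian_smult[OF D(2) fd] de by simp
      then obtain fs p where IH: "smith_chain m fs" "typed_seq e m fs" "valid_pairing e m fs p"
        "congruent_mat m (f \<cdot>\<^sub>m D) (canon e m fs p)" and
        dvd: "\<And>g. \<forall>i<m. \<forall>j<m. g dvd (f \<cdot>\<^sub>m D) $$ (i, j) \<Longrightarrow> \<forall>i<m. g dvd fs i"
        using less.IH[of m "f \<cdot>\<^sub>m D"] fD n by (metis less_Suc_eq)
      \<comment> \<open>The partner of \<open>f\<close>. It divides all entries of the remaining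
        matrix because q q* divides those of \<open>D\<close>, so it precedes the rest of the
        chain.\<close>
      define h where "h = f * q * pstar q"
      have h: "h = f * (q * pstar q)" "f dvd h" by (simp_all add: h_def mult.assoc)
      have h_dvd: "h dvd fs i" if "i < m" for i
        using dvd[of h] D qD that by (auto simp: h)
      define gs where "gs = case_nat f (case_nat h fs)"
      \<comment> \<open>The second index of a pair starts no pair; its value 0 is a default.\<close>
      define r where "r = case_nat q (case_nat 0 p)"
      have gs: "gs 0 = f" "gs (Suc 0) = h" "\<And>i. gs (Suc (Suc i)) = fs i" "r 0 = q" "\<And>i. r (Suc (Suc i)) = p i"
        by (simp_all add: gs_def r_def)
      have qnz: "q \<noteq> 0" using q by (simp add: pure_def)
      have odd0: "oddt e (Suc (Suc m)) gs 0" using fd de fnz gs by (simp add: oddt_def)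
      have odd1: "oddt e (Suc (Suc m)) gs (Suc 0)" using fd de fnz gs qnz by (simp add: oddt_def h_def ac_simps)
      have lch: "lead_coeff h = 1" unfolding h(1) lead_coeff_mult[of f] q(2) lc by simp
      have "smith_chain (Suc m) (case_nat h fs)" using IH(1) h_dvd lch by (rule smith_chain_case_nat)
      then have "smith_chain n gs" unfolding n gs_def
        by (rule smith_chain_case_nat) (use h_dvd h(2) lc in \<open>auto split: nat.split intro: dvd_trans\<close>)
      moreover have "typed_seq e n gs"
        unfolding n typed_seq_Suc[OF two e] using IH(2) odd0 odd1 oddt_shift[of e 1 "Suc m" gs 0] gs by simp
      moreover have "valid_pairing e n gs r"
        unfolding n valid_pairing_pair[OF two e odd0] using IH(3) odd1 gs q(1) by (simp add: h_def)
      moreover have "congruent_mat n A (canon e n gs r)"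
      proof (rule congruent_trans[OF A])
        have "congruent_mat n A (f \<cdot>\<^sub>m dsum (plane q (- pstar q)) D)"
          unfolding AB using congruent_smult[OF B] D(3) by blast
        then show "congruent_mat n A (dsum (plane (f * q) (- (f * pstar q))) (f \<cdot>\<^sub>m D))"
          by (simp add: smult_dsum smult_plane)
        show "congruent_mat n (dsum (plane (f * q) (- (f * pstar q))) (f \<cdot>\<^sub>m D)) (canon e n gs r)"
          unfolding n canon_pair[OF two e odd0 odd1] oddt_block[OF two e odd0]
          using congruent_dsum[OF mat22_carrier fD congruent_refl[OF mat22_carrier] IH(4), of 0 "f * q" "- (f * pstar q)" 0] gs
          by simp
      qed
      moreover have "\<forall>i<n. g dvd gs i" if "\<forall>i<n. \<forall>j<n. g dvd A $$ (i, j)" for g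
      proof -
        have "g dvd f" using content that by blast
        then show ?thesis using h_dvd h(2) unfolding n gs_def by (auto split: nat.split intro: dvd_trans)
      qed
      ultimately show ?thesis by blast
    qed
  qed
qed

theorem theorem5p2:
  fixes A :: "'a::alg_closed_field poly mat" and eps :: 'a and n :: nat
    and fs p :: "nat \<Rightarrow> 'a poly"
  assumes char: "(2::'a) \<noteq> 0"
    and eps: "eps = 1 \<or> eps = -1"
    and A: "A \<in> carrier_mat n n"
    and herm: "mat_star A = map_mat (Polynomial.smult eps) A"
    and inv: "invariant_factors n A fs"
    and pairing: "valid_pairing eps n fs p"
  shows "congruent_mat n A (canon eps n fs p) \<and>
    (\<forall>fs' p'. smith_chain n fs' \<and> typed_seq eps n fs' \<and> valid_pairing eps n fs' p' \<and>
        congruent_mat n A (canon eps n fs' p') \<longrightarrow> (\<forall>i<n. fs' i = fs i))"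
proof (rule conjI)
  have fs: "smith_chain n fs" "equivalent_mat n A (diag_of n fs)"
    using inv by (auto simp: invariant_factors_def equivalent_mat_def)
  \<comment> \<open>A canonical form is equivalent to the diagonal matrix of its own sequence, so
    uniqueness of the Smith form applies.\<close>
  have unique: "fs' i = fs i" if "smith_chain n fs'" "typed_seq eps n fs'" "valid_pairing eps n fs' p'"
    "congruent_mat n A (canon eps n fs' p')" "i < n" for fs' p' i
  proof (rule smith_chain_unique[OF _ fs(1) that(1,5)])
    have "equivalent_mat n A (diag_of n fs')"
      by (rule equivalent_trans[OF A congruent_imp_equivalent[OF that(4)]
            canon_equivalent_diag[OF char eps that(2,3)]])
    then show "equivalent_mat n (diag_of n fs) (diag_of n fs')"
      using equivalent_trans[of "diag_of n fs" n A "diag_of n fs'"] equivalent_sym[OF A fs(2)]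
      by (simp add: diag_of_def)
  qed
  then show "\<forall>fs' p'. smith_chain n fs' \<and> typed_seq eps n fs' \<and> valid_pairing eps n fs' p' \<and>
        congruent_mat n A (canon eps n fs' p') \<longrightarrow> (\<forall>i<n. fs' i = fs i)" by blast
  \<comment> \<open>The recursion yields some canonical form. Uniqueness identifies its sequence
    with \<open>fs\<close>, but its factors \<open>p'\<close> may differ from the given
    \<open>p\<close> and have to be exchanged.\<close>
  obtain fs' p' where fs': "smith_chain n fs'" "typed_seq eps n fs'" "valid_pairing eps n fs' p'"
    "congruent_mat n A (canon eps n fs' p')"
    using congruent_canon[OF char eps A herm] by blast
  then have same: "fs' i = fs i" if "i < n" for i using unique that by blast
  note c = canon_cong[of n fs' fs, OF same]
  have "congruent_mat n (canon eps n fs p') (canon eps n fs p)"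
    using canon_change_pairing[OF char eps _ _ pairing] fs' c by simp
  then show "congruent_mat n A (canon eps n fs p)"
    using congruent_trans[OF A] fs'(4) c(1) by simp
qed

end
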